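(* Let $b$ be a locally integrable function on $\mathbb{R}^n$ and let $0<\beta<1$. Then the following assertions are equivalent: (1) $b\in \dot{\Lambda}_{\beta}(\mathbb{R}^n)$. (2) $M_b$ is bounded from $L^{p(\cdot)}(\mathbb{R}^n)$ to $L^{q(\cdot)}(\mathbb{R}^n)$ for all $(p(\cdot),q(\cdot))\in \mathscr{B}_{p,q}^{\beta}(\mathbb{R}^n)$. (3) $M_b$ is bounded from $L^{p(\cdot)}(\mathbb{R}^n)$ to $L^{q(\cdot)}(\mathbb{R}^n)$ for some $(p(\cdot),q(\cdot))\in \mathscr{B}_{p,q}^{\beta}(\mathbb{R}^n)$. (4)$'$ There exists some $q(\cdot)\in\mathscr{B}(\mathbb{R}^n)$ such that $$\sup_{Q} \frac1{|Q|^{\beta/n}}\frac{\|(b-b_{Q})\chi_{Q}\|_{L^{q(\cdot)}(\mathbb{R}^n)}}{\|\chi_{Q}\|_{L^{q(\cdot)}(\mathbb{R}^n)}} <\infty.$$ (5)$'$ For all $q(\cdot)\in\mathscr{B}(\mathbb{R}^n)$, $$\sup_{Q} \frac1{|Q|^{\beta/n}}\frac{\|(b-b_{Q})\chi_{Q}\|_{L^{q(\cdot)}(\mathbb{R}^n)}}{\|\chi_{Q}\|_{L^{q(\cdot)}(\mathbb{R}^n)}} <\infty.$$ In (4)$'$ and (5)$'$ the suprema are over all cubes $Q\subset\mathbb{R}^n$.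
   Context: Functions are real-valued and identified when equal almost everywhere; in particular $b\in\dot{\Lambda}_\beta(\mathbb{R}^n)$ means that $b$ agrees a.e. with a function satisfying the condition below. A cube $Q\subset\mathbb{R}^n$ always has sides parallel to the coordinate axes; $|Q|$ is its Lebesgue measure, $\chi_Q$ its characteristic function, and $f_Q=|Q|^{-1}\int_Q f(x)\,dx$ for $f\in L^1_{\rm loc}(\mathbb{R}^n)$. Lipschitz space: for $0<\beta<1$, $b\in\dot{\Lambda}_{\beta}(\mathbb{R}^n)$ if there is a constant $C$ with $|b(x)-b(y)|\le C|x-y|^{\beta}$ for all $x,y\in\mathbb{R}^n$. Hardy-Littlewood maximal function: $M(f)(x)=\sup_{Q\ni x}\frac1{|Q|}\int_Q|f(y)|\,dy$. Maximal commutator: $M_b(f)(x)=\sup_{Q\ni x}\frac1{|Q|}\int_Q|b(x)-b(y)||f(y)|\,dy$. Both suprema are over all cubes $Q\subset\mathbb{R}^n$ containing $x$. Variable exponent Lebesgue space: for measurable $p(\cdot):\mathbb{R}^n\to[1,\infty)$, $L^{p(\cdot)}(\mathbb{R}^n)$ is the set of measurable $f$ with $\int_{\mathbb{R}^n}(|f(x)|/\lambda)^{p(x)}dx<\infty$ for some $\lambda>0$, with norm $\|f\|_{L^{p(\cdot)}(\mathbb{R}^n)}=\inf\{\lambda>0:\int_{\mathbb{R}^n}(|f(x)|/\lambda)^{p(x)}dx\le1\}$ (equal to $\infty$ if $f\notin L^{p(\cdot)}(\mathbb{R}^n)$). An operator $T$ is bounded from $L^{p(\cdot)}(\mathbb{R}^n)$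 to $L^{q(\cdot)}(\mathbb{R}^n)$ if there is a constant $C$ such that, for all $f\in L^{p(\cdot)}(\mathbb{R}^n)$, $Tf$ is defined a.e. and $\|Tf\|_{L^{q(\cdot)}(\mathbb{R}^n)}\le C\|f\|_{L^{p(\cdot)}(\mathbb{R}^n)}$. $\mathscr{P}(\mathbb{R}^n)$ is the set of measurable $p(\cdot):\mathbb{R}^n\to[1,\infty)$ with $1<p_-:=\operatorname{ess\,inf}_{x}p(x)$ and $p_+:=\operatorname{ess\,sup}_{x}p(x)<\infty$. $\mathscr{B}(\mathbb{R}^n)$ is the set of $p(\cdot)\in\mathscr{P}(\mathbb{R}^n)$ such that $M$ is bounded on $L^{p(\cdot)}(\mathbb{R}^n)$. An ordered pair $(p(\cdot),q(\cdot))$ of variable exponents belongs to $\mathscr{B}^{\alpha}_{p,q}(\mathbb{R}^n)$ if $p(\cdot)\in\mathscr{P}(\mathbb{R}^n)$, $0<\alpha<n/p_+$, $1/q(\cdot)=1/p(\cdot)-\alpha/n$, and $q(\cdot)(n-\alpha)/n\in\mathscr{B}(\mathbb{R}^n)$. *)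

theory Defs
  imports "HOL-Analysis.Analysis" "HOL-Probability.Essential_Supremum"
begin

text \<open>
  The space \<open>\<real>\<^sup>n\<close> is \<^typ>\<open>real ^ 'n\<close>, so \<open>n\<close> is \<open>CARD('n)\<close>. Functions are everywhere-defined
  representatives, and measurability is Lebesgue measurability (\<^const>\<open>lebesgue\<close>).
\<close>

definition locally_integrable :: "(real ^ 'n \<Rightarrow> real) \<Rightarrow> bool" where
  "locally_integrable f \<longleftrightarrow> (\<forall>K. compact K \<longrightarrow> set_integrable lebesgue K f)"

text \<open>Closed non-degenerate cubes; taking open or half-open cubes gives the same suprema.\<close>

definition cubes :: "(real ^ 'n) set set" where
  "cubes = {cbox a (\<chi> i. a $ i + l) | a l. 0 < l}"

definition cube_avg :: "(real ^ 'n \<Rightarrow> real) \<Rightarrow> (real ^ 'n) set \<Rightarrow> real" where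
  "cube_avg f Q = (LINT x:Q|lebesgue. f x) / measure lebesgue Q"

definition hom_lipschitz :: "real \<Rightarrow> (real ^ 'n \<Rightarrow> real) set" where
  "hom_lipschitz \<beta> = {b. \<exists>g. (AE x in lebesgue. b x = g x) \<and>
     (\<exists>C. \<forall>x y. \<bar>g x - g y\<bar> \<le> C * norm (x - y) powr \<beta>)}"

text \<open>Maximal operators take values in \<open>[0, \<infinity>]\<close>.\<close>

definition maximal_fun :: "(real ^ 'n \<Rightarrow> real) \<Rightarrow> real ^ 'n \<Rightarrow> ennreal" where
  "maximal_fun f x = (SUP Q\<in>{Q\<in>cubes. x \<in> Q}.
     (\<integral>\<^sup>+y\<in>Q. ennreal \<bar>f y\<bar> \<partial>lebesgue) / emeasure lebesgue Q)"

definition maximal_commutator ::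
    "(real ^ 'n \<Rightarrow> real) \<Rightarrow> (real ^ 'n \<Rightarrow> real) \<Rightarrow> real ^ 'n \<Rightarrow> ennreal" where
  "maximal_commutator b f x = (SUP Q\<in>{Q\<in>cubes. x \<in> Q}.
     (\<integral>\<^sup>+y\<in>Q. ennreal (\<bar>b x - b y\<bar> * \<bar>f y\<bar>) \<partial>lebesgue) / emeasure lebesgue Q)"

definition variable_exponents :: "(real ^ 'n \<Rightarrow> real) set" where
  "variable_exponents = {p \<in> borel_measurable lebesgue. \<forall>x. 1 \<le> p x}"

definition modular :: "(real ^ 'n \<Rightarrow> real) \<Rightarrow> (real ^ 'n \<Rightarrow> real) \<Rightarrow> ennreal" where
  "modular p f = (\<integral>\<^sup>+x. ennreal (\<bar>f x\<bar> powr p x) \<partial>lebesgue)"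

definition var_Lp :: "(real ^ 'n \<Rightarrow> real) \<Rightarrow> (real ^ 'n \<Rightarrow> real) set" where
  "var_Lp p = {f \<in> borel_measurable lebesgue. \<exists>t>0. modular p (\<lambda>x. f x / t) < \<infinity>}"

definition var_Lp_norm :: "(real ^ 'n \<Rightarrow> real) \<Rightarrow> (real ^ 'n \<Rightarrow> real) \<Rightarrow> ennreal" where
  "var_Lp_norm p f =
     (if f \<in> var_Lp p then INF t\<in>{t. 0 < t \<and> modular p (\<lambda>x. f x / t) \<le> 1}. ennreal t
      else \<infinity>)"

text \<open>
  ``Defined almost everywhere'' means finite almost everywhere; under that condition
  \<^const>\<open>enn2real\<close> only changes the values on a null set.
\<close>

definition bounded_operator ::
    "((real ^ 'n \<Rightarrow> real) \<Rightarrow> real ^ 'n \<Rightarrow> ennreal) \<Rightarrow>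
     (real ^ 'n \<Rightarrow> real) \<Rightarrow> (real ^ 'n \<Rightarrow> real) \<Rightarrow> bool" where
  "bounded_operator T p q \<longleftrightarrow> (\<exists>C::real. \<forall>f\<in>var_Lp p.
     (AE x in lebesgue. T f x < \<infinity>) \<and>
     var_Lp_norm q (\<lambda>x. enn2real (T f x)) \<le> ennreal C * var_Lp_norm p f)"

definition exp_minus :: "(real ^ 'n \<Rightarrow> real) \<Rightarrow> ereal" where
  "exp_minus p = Sup {z. AE x in lebesgue. z \<le> ereal (p x)}"

definition exp_plus :: "(real ^ 'n \<Rightarrow> real) \<Rightarrow> ereal" where
  "exp_plus p = esssup lebesgue (\<lambda>x. ereal (p x))"

definition exponents_P :: "(real ^ 'n \<Rightarrow> real) set" where
  "exponents_P = {p \<in> variable_exponents. 1 < exp_minus p \<and> exp_plus p < \<infinity>}"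

definition exponents_B :: "(real ^ 'n \<Rightarrow> real) set" where
  "exponents_B = {p \<in> exponents_P. bounded_operator maximal_fun p p}"

text \<open>
  The relation between the exponents is required almost everywhere, in line with the
  identification of functions that agree almost everywhere.
\<close>

definition exponent_pairs :: "real \<Rightarrow> ((real ^ 'n \<Rightarrow> real) \<times> (real ^ 'n \<Rightarrow> real)) set" where
  "exponent_pairs \<alpha> = {(p, q). p \<in> exponents_P \<and> q \<in> variable_exponents \<and>
     0 < \<alpha> \<and> ereal \<alpha> < ereal (real CARD('n)) / exp_plus p \<and>
     (AE x in lebesgue. 1 / q x = 1 / p x - \<alpha> / real CARD('n)) \<and>
     (\<lambda>x. q x * (real CARD('n) - \<alpha>) / real CARD('n)) \<in> exponents_B}"

definition osc_sup :: "real \<Rightarrow> (real ^ 'n \<Rightarrow> real) \<Rightarrow> (real ^ 'n \<Rightarrow> real) \<Rightarrow> ennreal" where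
  "osc_sup \<beta> q b = (SUP Q\<in>cubes.
     ennreal (1 / measure lebesgue Q powr (\<beta> / real CARD('n))) *
     (var_Lp_norm q (\<lambda>x. (b x - cube_avg b Q) * indicator Q x) /
      var_Lp_norm q (indicator Q)))"

end

theory Submission
  imports Defs
begin

text \<open>
  Let \<open>\<theta> = \<beta> / n\<close> and \<open>s = (1 - \<theta>) q\<close>. For Lipschitz \<open>b\<close> one has \<open>M\<^sub>b f \<le> L M\<^sub>\<beta> f\<close> with the fractional maximal
  function \<open>M\<^sub>\<beta>\<close>. If \<open>\<integral>|f|\<^sup>p \<le> 1\<close>, Hoelder with the constant exponents \<open>1 / (1 - \<theta>)\<close> and \<open>1 / \<theta>\<close>,
  applied to \<open>|f| = G powr (1 - \<theta>) * (|f| powr p) powr \<theta>\<close> with \<open>G = |f| powr (p / s)\<close>, gives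
  \<open>M\<^sub>\<beta> f \<le> (M G) powr (1 - \<theta>)\<close>; as \<open>\<integral>G\<^sup>s = \<integral>|f|\<^sup>p\<close>, boundedness of \<open>M\<close> on \<open>L\<^sup>s\<close> yields that of \<open>M\<^sub>b\<close>.

  Conversely \<open>|b - b\<^sub>Q| \<chi>\<^sub>Q \<le> M\<^sub>b \<chi>\<^sub>Q\<close> together with \<open>\<parallel>\<chi>\<^sub>Q\<parallel>\<^sub>p \<le> 2 |Q|\<^sup>\<theta> \<parallel>\<chi>\<^sub>Q\<parallel>\<^sub>q\<close> bounds the oscillation in
  \<open>L\<^sup>q\<close>, and \<open>q\<close> is in \<open>\<B>\<close> because \<open>(M f)\<^sup>c \<le> M (|f|\<^sup>c)\<close> for \<open>c > 1\<close>. Since \<open>|f|\<^sub>Q \<chi>\<^sub>Q \<le> M f\<close>, boundedness of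
  \<open>M\<close> on \<open>L\<^sup>q\<close> turns that bound into \<open>|b - b\<^sub>Q|\<^sub>Q \<le> A |Q|\<^sup>\<theta>\<close>, and Campanato's telescoping argument makes
  \<open>b\<close> Lipschitz. The classes of exponents are nonempty because \<open>M\<close> is bounded on \<open>L\<^sup>2\<close>:
  \<open>q = 2n / (n - \<beta>)\<close> corresponds to \<open>s = 2\<close>.
\<close>

section \<open>Modular and norm\<close>

lemma variable_exponents_measurable [measurable_dest]:
  "p \<in> variable_exponents \<Longrightarrow> p \<in> borel_measurable lebesgue"
  by (simp add: variable_exponents_def)

lemma variable_exponents_ge_1: "p \<in> variable_exponents \<Longrightarrow> 1 \<le> p x"
  by (simp add: variable_exponents_def)

lemma modular_mono_AE:
  assumes p: "p \<in> variable_exponents" and le: "AE x in lebesgue. \<bar>f x\<bar> \<le> \<bar>g x\<bar>"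
  shows "modular p f \<le> modular p g"
  unfolding modular_def
proof (rule nn_integral_mono_AE)
  show "AE x in lebesgue. ennreal (\<bar>f x\<bar> powr p x) \<le> ennreal (\<bar>g x\<bar> powr p x)"
    using le
  proof eventually_elim
    case (elim x)
    then show ?case
      using variable_exponents_ge_1[OF p, of x] by (intro ennreal_leI powr_mono2) auto
  qed
qed

text \<open>As \<open>p x\<close> is at least 1 and \<open>1 / c\<close> at most 1, the factor
  \<open>(1 / c) powr p x\<close> is at most \<open>1 / c\<close>. Enlarging the scale thus pushes
  any finite modular below 1.\<close>

lemma modular_divide_le:
  fixes f :: "real ^ 'n \<Rightarrow> real"
  assumes p: "p \<in> variable_exponents" and f[measurable]: "f \<in> borel_measurable lebesgue"
    and c: "1 \<le> c" and t: "0 < t"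
  shows "modular p (\<lambda>x. f x / (t * c)) \<le> ennreal (1 / c) * modular p (\<lambda>x. f x / t)"
proof -
  note [measurable] = variable_exponents_measurable[OF p]
  have "\<bar>f x / (t * c)\<bar> powr p x \<le> 1 / c * \<bar>f x / t\<bar> powr p x" for x
  proof -
    have "\<bar>f x / (t * c)\<bar> = (1 / c) * \<bar>f x / t\<bar>"
      using c t by (simp add: abs_mult)
    then have "\<bar>f x / (t * c)\<bar> powr p x = (1 / c) powr p x * \<bar>f x / t\<bar> powr p x"
      using c by (simp only: powr_mult)
    moreover have "(1 / c) powr p x \<le> (1 / c) powr 1"
      using c variable_exponents_ge_1[OF p, of x] by (intro powr_mono') auto
    ultimately show ?thesis
      using c by (metis mult_right_mono powr_ge_zero powr_one zero_le_divide_1_iff order_trans zero_le_one)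
  qed
  then have "modular p (\<lambda>x. f x / (t * c)) \<le>
      (\<integral>\<^sup>+x. ennreal (1 / c) * ennreal (\<bar>f x / t\<bar> powr p x) \<partial>lebesgue)"
    unfolding modular_def using c
    by (intro nn_integral_mono) (simp add: ennreal_mult[symmetric] ennreal_leI del: abs_divide)
  also have "\<dots> = ennreal (1 / c) * modular p (\<lambda>x. f x / t)"
    unfolding modular_def by (intro nn_integral_cmult) measurable
  finally show ?thesis .
qed

section \<open>Comparison of the Luxemburg norm with the modular\<close>

lemma var_Lp_norm_le:
  assumes "f \<in> borel_measurable lebesgue" "0 < t" "modular p (\<lambda>x. f x / t) \<le> 1"
  shows "var_Lp_norm p f \<le> ennreal t"
proof -
  have "f \<in> var_Lp p"
    unfolding var_Lp_def using assms le_less_trans[OF assms(3) ennreal_one_less_top]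
    by (auto simp: top_unique less_top)
  then show ?thesis
    unfolding var_Lp_norm_def using assms by (auto intro!: INF_lower2[of t])
qed

text \<open>The strict inequality supplies an admissible scale \<open>s < t\<close>, and the modular
  decreases as the scale grows.\<close>

lemma var_Lp_norm_less_modular:
  assumes p: "p \<in> variable_exponents" and less: "var_Lp_norm p f < ennreal t"
  shows "f \<in> var_Lp p" "0 < t" "modular p (\<lambda>x. f x / t) \<le> 1"
proof -
  show f: "f \<in> var_Lp p"
    using less by (auto simp: var_Lp_norm_def split: if_splits)
  obtain s where s: "0 < s" "modular p (\<lambda>x. f x / s) \<le> 1" "ennreal s < ennreal t"
    using less f by (auto simp: var_Lp_norm_def INF_less_iff)
  then have st: "s < t"
    by (simp add: ennreal_less_iff)
  then show "0 < t"
    using s by simp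
  have "modular p (\<lambda>x. f x / t) \<le> modular p (\<lambda>x. f x / s)"
    using s(1) st
    by (intro modular_mono_AE[OF p] AE_I2) (auto simp: abs_divide intro!: divide_left_mono)
  with s(2) show "modular p (\<lambda>x. f x / t) \<le> 1"
    by simp
qed

lemma var_Lp_norm_finite:
  assumes p: "p \<in> variable_exponents" and f: "f \<in> var_Lp p"
  shows "var_Lp_norm p f < \<infinity>"
proof -
  obtain t where t: "0 < t" "modular p (\<lambda>x. f x / t) < \<infinity>" and [measurable]: "f \<in> borel_measurable lebesgue"
    using f by (auto simp: var_Lp_def)
  \<comment> \<open>Dividing by a number at least as large as the modular brings the modular down to
    at most 1; the maximum with 1 meets the hypothesis of \<open>modular_divide_le\<close>.\<close>
  define c where "c = max 1 (enn2real (modular p (\<lambda>x. f x / t)))"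
  have c: "1 \<le> c" "modular p (\<lambda>x. f x / t) \<le> ennreal c"
    using t(2) order_trans[OF _ ennreal_leI[OF max.cobounded2]] by (auto simp: c_def ennreal_enn2real)
  have "modular p (\<lambda>x. f x / (t * c)) \<le> ennreal (1 / c) * modular p (\<lambda>x. f x / t)"
    using c t by (intro modular_divide_le[OF p]) auto
  also have "\<dots> \<le> ennreal (1 / c) * ennreal c"
    using c by (intro mult_left_mono) auto
  also have "\<dots> = 1"
    using c by (simp add: ennreal_mult[symmetric])
  finally have "var_Lp_norm p f \<le> ennreal (t * c)"
    using c t by (intro var_Lp_norm_le) auto
  also have "\<dots> < \<infinity>"
    by simp
  finally show ?thesis .
qed

text \<open>Every scale \<open>r + e\<close> strictly above the norm \<open>r\<close> of
  \<open>f\<close> is admissible, so \<open>step\<close> bounds the norm of \<open>g\<close> by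
  \<open>C * (r + e)\<close>; then \<open>e\<close> tends to 0 from the right. An infinite norm of
  \<open>f\<close> makes the claim trivial because \<open>C\<close> is positive.\<close>

lemma var_Lp_norm_leI:
  assumes p: "p \<in> variable_exponents" and g: "g \<in> borel_measurable lebesgue"
    and C: "0 < C"
    and step: "\<And>t. 0 < t \<Longrightarrow> f \<in> var_Lp p \<Longrightarrow> modular p (\<lambda>x. f x / t) \<le> 1 \<Longrightarrow> modular q (\<lambda>x. g x / (C * t)) \<le> 1"
  shows "var_Lp_norm q g \<le> ennreal C * var_Lp_norm p f"
proof (cases "var_Lp_norm p f < \<infinity>")
  case False
  then have "var_Lp_norm p f = \<infinity>"
    by (metis infinity_ennreal_def top.not_eq_extremum)
  then show ?thesis
    using C by (simp add: ennreal_mult_top)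
next
  case True
  have "var_Lp_norm q g \<le> ennreal C * (var_Lp_norm p f + ennreal e)" if "0 < e" for e
  proof -
    obtain r where r: "0 \<le> r" "var_Lp_norm p f = ennreal r"
      using True by (cases "var_Lp_norm p f") auto
    have "var_Lp_norm p f < ennreal (r + e)"
      using r that by (simp add: ennreal_less_iff)
    note * = var_Lp_norm_less_modular[OF p this]
    have "var_Lp_norm q g \<le> ennreal (C * (r + e))"
      using C * by (intro var_Lp_norm_le g step) auto
    also have "\<dots> = ennreal C * (var_Lp_norm p f + ennreal e)"
      using C r that by (simp add: ennreal_mult)
    finally show ?thesis .
  qed
  note * = this
  have "((\<lambda>e. ennreal C * (var_Lp_norm p f + ennreal e)) \<longlongrightarrow> ennreal C * (var_Lp_norm p f + ennreal 0)) (at_right 0)"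
    by (intro ennreal_tendsto_cmult tendsto_add tendsto_ennrealI tendsto_ident_at tendsto_const) auto
  then have "var_Lp_norm q g \<le> ennreal C * (var_Lp_norm p f + ennreal 0)"
    by (rule tendsto_lowerbound) (use eventually_mono[OF eventually_at_right_less *] in simp_all)
  then show ?thesis
    by simp
qed

lemma var_Lp_norm_mono_AE:
  assumes p: "p \<in> variable_exponents" and f: "f \<in> borel_measurable lebesgue"
    and C: "0 < C" and le: "AE x in lebesgue. \<bar>f x\<bar> \<le> C * \<bar>g x\<bar>"
  shows "var_Lp_norm p f \<le> ennreal C * var_Lp_norm p g"
proof (rule var_Lp_norm_leI[OF p f C])
  fix t :: real assume t: "0 < t" "modular p (\<lambda>x. g x / t) \<le> 1"
  have "modular p (\<lambda>x. f x / (C * t)) \<le> modular p (\<lambda>x. g x / t)"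
    using le by (intro modular_mono_AE[OF p]) (use C t in \<open>auto elim!: eventually_mono simp: abs_mult field_simps\<close>)
  with t show "modular p (\<lambda>x. f x / (C * t)) \<le> 1" by simp
qed

text \<open>This trades the infimum in the norm for one implication between modulars at every scale
  \<open>t\<close>, the form in which pointwise estimates can be integrated. Measurability of the
  image appears explicitly because membership in \<open>var_Lp q\<close> contains it.\<close>

lemma bounded_operator_iff_modular:
  fixes p q :: "real ^ 'n \<Rightarrow> real"
  assumes p: "p \<in> variable_exponents" and q: "q \<in> variable_exponents"
  shows "bounded_operator T p q \<longleftrightarrow>
    (\<exists>C>0. \<forall>f\<in>borel_measurable lebesgue. \<forall>t>0. modular p (\<lambda>x. f x / t) \<le> 1 \<longrightarrow>
       (AE x in lebesgue. T f x < \<infinity>) \<and> (\<lambda>x. enn2real (T f x)) \<in> borel_measurable lebesgue \<and>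
       modular q (\<lambda>x. enn2real (T f x) / (C * t)) \<le> 1)"
    (is "_ \<longleftrightarrow> (\<exists>C>0. ?P C)")
proof
  assume "bounded_operator T p q"
  then obtain C where C: "\<And>f. f \<in> var_Lp p \<Longrightarrow> AE x in lebesgue. T f x < \<infinity>"
     "\<And>f. f \<in> var_Lp p \<Longrightarrow> var_Lp_norm q (\<lambda>x. enn2real (T f x)) \<le> ennreal C * var_Lp_norm p f"
    unfolding bounded_operator_def by blast
  \<comment> \<open>The constant of a bounded operator may be negative, hence the absolute value;
    the added 1 makes the norm estimate strict, as \<open>var_Lp_norm_less_modular\<close>
    demands.\<close>
  have "?P (\<bar>C\<bar> + 1)"
  proof (intro ballI allI impI)
    fix f :: "real ^ 'n \<Rightarrow> real" and t :: real
    assume f: "f \<in> borel_measurable lebesgue" and t: "0 < t" and m: "modular p (\<lambda>x. f x / t) \<le> 1"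
    have fp: "f \<in> var_Lp p"
      unfolding var_Lp_def using f t le_less_trans[OF m ennreal_one_less_top]
      by (auto simp: top_unique less_top)
    have "var_Lp_norm q (\<lambda>x. enn2real (T f x)) \<le> ennreal C * ennreal t"
      by (rule order_trans[OF C(2)[OF fp]]) (intro mult_left_mono var_Lp_norm_le f t m zero_le)
    also have "\<dots> \<le> ennreal (\<bar>C\<bar> * t)"
      using t by (cases "0 \<le> C") (auto simp: ennreal_mult[symmetric] ennreal_neg intro!: ennreal_leI)
    also have "\<dots> < ennreal ((\<bar>C\<bar> + 1) * t)"
      using t by (intro ennreal_lessI) auto
    finally have "var_Lp_norm q (\<lambda>x. enn2real (T f x)) < ennreal ((\<bar>C\<bar> + 1) * t)" .
    note * = var_Lp_norm_less_modular[OF q this]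
    from * C(1)[OF fp]
    show "(AE x in lebesgue. T f x < \<infinity>) \<and> (\<lambda>x. enn2real (T f x)) \<in> borel_measurable lebesgue \<and>
       modular q (\<lambda>x. enn2real (T f x) / ((\<bar>C\<bar> + 1) * t)) \<le> 1"
      by (auto simp: var_Lp_def)
  qed
  then show "\<exists>C>0. ?P C"
    by (intro exI[of _ "\<bar>C\<bar> + 1"]) auto
next
  assume "\<exists>C>0. ?P C"
  then obtain C where C: "0 < C" "?P C" by blast
  show "bounded_operator T p q"
    unfolding bounded_operator_def
  proof (intro exI[of _ C] ballI)
    fix f assume f: "f \<in> var_Lp p"
    obtain t where t: "0 < t" "modular p (\<lambda>x. f x / t) \<le> 1"
    proof -
      obtain r where r: "0 \<le> r" "var_Lp_norm p f = ennreal r"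
        using var_Lp_norm_finite[OF p f] by (cases "var_Lp_norm p f") auto
      then have "var_Lp_norm p f < ennreal (r + 1)"
        by (simp add: ennreal_less_iff)
      from that var_Lp_norm_less_modular[OF p this] show ?thesis by blast
    qed
    have fm: "f \<in> borel_measurable lebesgue"
      using f by (simp add: var_Lp_def)
    show "(AE x in lebesgue. T f x < \<infinity>) \<and>
     var_Lp_norm q (\<lambda>x. enn2real (T f x)) \<le> ennreal C * var_Lp_norm p f"
    proof
      show "AE x in lebesgue. T f x < \<infinity>"
        using C(2) fm t by blast
      show "var_Lp_norm q (\<lambda>x. enn2real (T f x)) \<le> ennreal C * var_Lp_norm p f"
        using C fm t by (intro var_Lp_norm_leI[OF p]) blast+
    qed
  qed
qed

section \<open>Cubes and measurability of maximal functions\<close>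

lemma divide_le_ennreal_iff:
  fixes a b c :: ennreal
  assumes "b \<noteq> 0" "b < top"
  shows "a / b \<le> c \<longleftrightarrow> a \<le> c * b"
proof
  assume "a / b \<le> c"
  then have "a / b * b \<le> c * b"
    by (rule mult_right_mono) simp
  then show "a \<le> c * b"
    using assms by (simp add: ennreal_divide_times)
next
  assume "a \<le> c * b"
  then have "a / b \<le> c * b / b"
    by (rule divide_right_mono_ennreal)
  then show "a / b \<le> c"
    using assms by (simp add: ennreal_mult_divide_eq)
qed

lemma less_divide_ennreal_iff:
  fixes a b c :: ennreal
  assumes "b \<noteq> 0" "b < top"
  shows "c < a / b \<longleftrightarrow> c * b < a"
  using divide_le_ennreal_iff[OF assms] by (simp flip: not_le)

section \<open>Cubes parametrised by lower corner and side length\<close>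

definition cube :: "real ^ 'n \<Rightarrow> real \<Rightarrow> (real ^ 'n) set" where
  "cube a l = cbox a (\<chi> i. a $ i + l)"

lemma cubes_iff: "Q \<in> cubes \<longleftrightarrow> (\<exists>a l. 0 < l \<and> Q = cube a l)"
  unfolding cubes_def cube_def by auto

lemma mem_cube: "x \<in> cube a l \<longleftrightarrow> (\<forall>i. a $ i \<le> x $ i \<and> x $ i \<le> a $ i + l)"
  by (simp add: cube_def mem_box_cart)

lemma cube_subset:
  assumes "\<And>i. b $ i \<le> a $ i \<and> a $ i + l \<le> b $ i + m"
  shows "cube a l \<subseteq> cube b m"
proof
  fix x assume x: "x \<in> cube a l"
  show "x \<in> cube b m"
    unfolding mem_cube
  proof
    fix i show "b $ i \<le> x $ i \<and> x $ i \<le> b $ i + m"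
      using x assms[of i] unfolding mem_cube by (auto dest!: spec[of _ i])
  qed
qed

lemma compact_cube [simp]: "compact (cube a l)"
  by (simp add: cube_def)

lemma sets_cube [measurable, simp]: "cube a l \<in> sets lebesgue"
  by (simp add: cube_def)

lemma measure_cube:
  fixes a :: "real ^ 'n"
  assumes "0 \<le> l"
  shows "measure lebesgue (cube a l) = l ^ CARD('n)"
proof -
  have "cube a l \<noteq> {}"
    using assms by (auto simp: mem_cube set_eq_iff intro!: exI[of _ a])
  then show ?thesis
    using content_cbox_cart[of a "\<chi> i. a $ i + l"] assms by (simp add: cube_def)
qed

lemma emeasure_cube:
  fixes a :: "real ^ 'n"
  assumes "0 \<le> l"
  shows "emeasure lebesgue (cube a l) = ennreal (l ^ CARD('n))"
  using measure_cube[OF assms, of a] emeasure_lborel_cbox_finite[of a "\<chi> i. a $ i + l"]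
  by (subst emeasure_eq_ennreal_measure) (auto simp: cube_def)

lemma interior_cube: "interior (cube a l) = box a (\<chi> i. a $ i + l)"
  by (simp add: cube_def)

text \<open>The l1 norm dominates the Euclidean norm. The factor n, larger than the sharp square
  root of n, only affects constants.\<close>

lemma dist_cube_le:
  fixes a :: "real ^ 'n"
  assumes "x \<in> cube a l" "y \<in> cube a l"
  shows "norm (x - y) \<le> real CARD('n) * l"
proof -
  have "norm (x - y) \<le> (\<Sum>i\<in>UNIV. \<bar>(x - y) $ i\<bar>)"
    by (rule norm_le_l1_cart)
  also have "\<dots> \<le> (\<Sum>i\<in>(UNIV::'n set). l)"
    using assms unfolding mem_cube
    by (intro sum_mono) (auto simp: abs_le_iff, smt+)
  finally show ?thesis by simp
qed

text \<open>If the average over some cube exceeds \<open>t\<close>, it still does after a slight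
  enlargement of the cube, and \<open>x\<close> is then an interior point. Near \<open>x\<close> all
  points lie in the enlarged cube and, by \<open>op\<close>, keep the large integral. The kernel
  \<open>k\<close> may depend on \<open>x\<close> so that the result covers the commutator
  too.\<close>

lemma open_maximal_superlevel:
  fixes k :: "real ^ 'n \<Rightarrow> real ^ 'n \<Rightarrow> ennreal"
  assumes op: "\<And>Q t. Q \<in> cubes \<Longrightarrow> open {x. t < (\<integral>\<^sup>+y\<in>Q. k x y \<partial>lebesgue)}"
  shows "open {x. t < (SUP Q\<in>{Q\<in>cubes. x \<in> Q}. (\<integral>\<^sup>+y\<in>Q. k x y \<partial>lebesgue) / emeasure lebesgue Q)}"
    (is "open ?S")
proof (subst open_subopen, intro ballI)
  fix x assume "x \<in> ?S"
  then obtain a l where l: "0 < l" and xQ: "x \<in> cube a l"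
    and less: "t < (\<integral>\<^sup>+y\<in>cube a l. k x y \<partial>lebesgue) / emeasure lebesgue (cube a l)"
    by (auto simp: less_SUP_iff cubes_iff)
  define I where "I = (\<integral>\<^sup>+y\<in>cube a l. k x y \<partial>lebesgue)"
  have t_fin: "t \<noteq> \<infinity>"
    using less by auto
  \<comment> \<open>The volume is written as the value at \<open>e = 0\<close> of the expression
    whose limit is taken next.\<close>
  have "t * ennreal ((l + 2 * 0) ^ CARD('n)) < I"
    using less l unfolding emeasure_cube[OF less_imp_le[OF l], of a] I_def
    by (intro less_divide_ennreal_iff[THEN iffD1]) simp_all
  moreover have "((\<lambda>e. t * ennreal ((l + 2 * e) ^ CARD('n))) \<longlongrightarrow> t * ennreal ((l + 2 * 0) ^ CARD('n))) (at_right 0)"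
    using t_fin by (intro ennreal_tendsto_cmult tendsto_intros) (auto simp: less_top)
  ultimately have "eventually (\<lambda>e. t * ennreal ((l + 2 * e) ^ CARD('n)) < I) (at_right 0)"
    by (rule order_tendstoD(2)[rotated])
  moreover have "eventually (\<lambda>e::real. 0 < e) (at_right 0)"
    by (simp add: eventually_at_right_less)
  ultimately have "eventually (\<lambda>e. t * ennreal ((l + 2 * e) ^ CARD('n)) < I \<and> 0 < e) (at_right 0)"
    by (rule eventually_conj)
  from eventually_happens'[OF trivial_limit_at_right_real this]
  obtain e where e: "0 < e" "t * ennreal ((l + 2 * e) ^ CARD('n)) < I"
    by blast
  \<comment> \<open>Moving the corner by \<open>e\<close> and adding \<open>2 * e\<close> to the
    side enlarges the cube by \<open>e\<close> in every coordinate direction.\<close>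
  define a' where "a' = (\<chi> i. a $ i - e)"
  define Q where "Q = cube a' (l + 2 * e)"
  have Q: "Q \<in> cubes"
    unfolding Q_def cubes_iff using e(1) l by (auto intro!: exI[of _ a'] exI[of _ "l + 2 * e"])
  have eQ: "emeasure lebesgue Q = ennreal ((l + 2 * e) ^ CARD('n))"
    unfolding Q_def using l e by (intro emeasure_cube) simp
  have "I \<le> (\<integral>\<^sup>+y\<in>Q. k x y \<partial>lebesgue)"
    unfolding I_def Q_def
    by (intro nn_set_integral_set_mono cube_subset) (use e in \<open>auto simp: a'_def\<close>)
  then have xin: "t * ennreal ((l + 2 * e) ^ CARD('n)) < (\<integral>\<^sup>+y\<in>Q. k x y \<partial>lebesgue)"
    using e(2) by simp
  let ?T = "interior Q \<inter> {z. t * ennreal ((l + 2 * e) ^ CARD('n)) < (\<integral>\<^sup>+y\<in>Q. k z y \<partial>lebesgue)}"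
  have "x \<in> interior Q"
    using xQ e(1) unfolding Q_def interior_cube mem_box_cart mem_cube
    by (auto simp: a'_def intro: le_less_trans less_le_trans, smt+)
  then have "x \<in> ?T" using xin by simp
  moreover have "open ?T"
    by (intro open_Int open_interior op Q)
  moreover have "?T \<subseteq> ?S"
  proof
    fix z assume z: "z \<in> ?T"
    then have "t < (\<integral>\<^sup>+y\<in>Q. k z y \<partial>lebesgue) / emeasure lebesgue Q"
      using l e unfolding eQ by (intro less_divide_ennreal_iff[THEN iffD2]) simp_all
    moreover have "z \<in> Q" using z interior_subset by auto
    ultimately show "z \<in> ?S"
      using Q by (auto simp: less_SUP_iff)
  qed
  ultimately show "\<exists>T. open T \<and> x \<in> T \<and> T \<subseteq> ?S" by blast
qed

lemma borel_measurable_maximal_fun: "maximal_fun f \<in> borel_measurable borel"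
proof (rule borel_measurableI_greater)
  fix t
  have "open {x. t < maximal_fun f x}"
    unfolding maximal_fun_def by (rule open_maximal_superlevel) (simp add: open_Collect_const)
  then show "{x \<in> space borel. t < maximal_fun f x} \<in> sets borel"
    by simp
qed

text \<open>For a fixed cube, moving \<open>x\<close> to \<open>z\<close> changes the integral by at
  most \<open>\<bar>g x - g z\<bar>\<close> times the mass of \<open>f\<close> on the cube. That
  mass is finite, so continuity of \<open>g\<close> makes the integral depend continuously on
  \<open>x\<close>, and \<open>open_maximal_superlevel\<close> applies.\<close>

lemma borel_measurable_maximal_commutator:
  fixes g f :: "real ^ 'n \<Rightarrow> real"
  assumes g: "continuous_on UNIV g" and [measurable]: "f \<in> borel_measurable lebesgue"
    and fin: "\<And>a l. 0 < l \<Longrightarrow> (\<integral>\<^sup>+y\<in>cube a l. ennreal \<bar>f y\<bar> \<partial>lebesgue) < \<infinity>"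
  shows "maximal_commutator g f \<in> borel_measurable borel"
proof (rule borel_measurableI_greater)
  fix t
  have [measurable]: "g \<in> borel_measurable lebesgue"
    using borel_measurable_continuous_onI[OF g] by (simp add: measurable_completion)
  have "open {x. s < (\<integral>\<^sup>+y\<in>Q. ennreal (\<bar>g x - g y\<bar> * \<bar>f y\<bar>) \<partial>lebesgue)}" if "Q \<in> cubes" for Q s
  proof -
    obtain a l where l: "0 < l" and Q: "Q = cube a l"
      using \<open>Q \<in> cubes\<close> by (auto simp: cubes_iff)
    let ?F = "\<lambda>x. (\<integral>\<^sup>+y\<in>Q. ennreal (\<bar>g x - g y\<bar> * \<bar>f y\<bar>) \<partial>lebesgue)"
    let ?I = "(\<integral>\<^sup>+y\<in>Q. ennreal \<bar>f y\<bar> \<partial>lebesgue)"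
    have F_le: "?F x \<le> ?F z + ennreal \<bar>g x - g z\<bar> * ?I" for x z
    proof -
      have "?F x \<le> (\<integral>\<^sup>+y. ennreal (\<bar>g z - g y\<bar> * \<bar>f y\<bar>) * indicator Q y
          + ennreal \<bar>g x - g z\<bar> * (ennreal \<bar>f y\<bar> * indicator Q y) \<partial>lebesgue)"
      proof (intro nn_integral_mono)
        fix y
        have "\<bar>g x - g y\<bar> * \<bar>f y\<bar> \<le> \<bar>g z - g y\<bar> * \<bar>f y\<bar> + \<bar>g x - g z\<bar> * \<bar>f y\<bar>"
          unfolding distrib_right[symmetric] by (intro mult_right_mono) auto
        then show "ennreal (\<bar>g x - g y\<bar> * \<bar>f y\<bar>) * indicator Q y \<le> 
          ennreal (\<bar>g z - g y\<bar> * \<bar>f y\<bar>) * indicator Q y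
          + ennreal \<bar>g x - g z\<bar> * (ennreal \<bar>f y\<bar> * indicator Q y)"
          by (auto simp: indicator_def ennreal_mult[symmetric] ennreal_plus[symmetric] 
              simp del: ennreal_plus intro!: ennreal_leI)
      qed
      also have "\<dots> = ?F z + ennreal \<bar>g x - g z\<bar> * ?I"
        unfolding Q by (subst nn_integral_add) (auto simp: nn_integral_cmult)
      finally show ?thesis .
    qed
    have "closed {x. ?F x \<le> s}"
      unfolding closed_sequential_limits
    proof (intro allI impI, elim conjE)
      fix X x assume X: "\<forall>n. X n \<in> {x. ?F x \<le> s}" and lim: "X \<longlonglongrightarrow> x"
      have gl: "(\<lambda>n. g (X n)) \<longlonglongrightarrow> g x"
        using g lim by (auto intro: continuous_on_tendsto_compose[of UNIV])
      have "(\<lambda>n. s + ?I * ennreal \<bar>g x - g (X n)\<bar>) \<longlonglongrightarrow> s + ?I * ennreal \<bar>g x - g x\<bar>"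
        using fin[OF l, of a] by (intro tendsto_intros ennreal_tendsto_cmult gl tendsto_ennrealI) (auto simp: Q)
      then have "?F x \<le> s + ?I * ennreal \<bar>g x - g x\<bar>"
      proof (rule LIMSEQ_le_const, intro exI allI impI)
        fix n
        show "?F x \<le> s + ?I * ennreal \<bar>g x - g (X n)\<bar>"
          using F_le[of x "X n"] X by (simp add: mult.commute[of ?I]) (meson add_right_mono order_trans)
      qed
      then show "x \<in> {x. ?F x \<le> s}" by simp
    qed
    then have "open (- {x. ?F x \<le> s})"
      by (rule open_Compl)
    also have "- {x. ?F x \<le> s} = {x. s < ?F x}"
      by auto
    finally show ?thesis .
  qed
  then have "open {x. t < maximal_commutator g f x}"
    unfolding maximal_commutator_def by (rule open_maximal_superlevel)
  then show "{x \<in> space borel. t < maximal_commutator g f x} \<in> sets borel"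
    by simp
qed

lemma avg_le_maximal_fun:
  assumes "0 < l" "x \<in> cube a l"
  shows "(\<integral>\<^sup>+y\<in>cube a l. ennreal \<bar>f y\<bar> \<partial>lebesgue) \<le> maximal_fun f x * emeasure lebesgue (cube a l)"
proof -
  have "(\<integral>\<^sup>+y\<in>cube a l. ennreal \<bar>f y\<bar> \<partial>lebesgue) / emeasure lebesgue (cube a l) \<le> maximal_fun f x"
    unfolding maximal_fun_def using assms by (intro SUP_upper) (auto simp: cubes_iff)
  then show ?thesis
    unfolding emeasure_cube[OF less_imp_le[OF assms(1)], of a]
    using assms by (intro divide_le_ennreal_iff[THEN iffD1]) simp_all
qed

lemma maximal_fun_cong_AE:
  assumes "AE x in lebesgue. \<bar>f x\<bar> = \<bar>g x\<bar>"
  shows "maximal_fun f = maximal_fun g"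
proof
  fix x
  have "(\<integral>\<^sup>+y\<in>Q. ennreal \<bar>f y\<bar> \<partial>lebesgue) = (\<integral>\<^sup>+y\<in>Q. ennreal \<bar>g y\<bar> \<partial>lebesgue)" for Q
    using assms by (intro nn_integral_cong_AE) auto
  then show "maximal_fun f x = maximal_fun g x"
    by (simp add: maximal_fun_def)
qed

section \<open>The maximal function on square integrable functions\<close>

text \<open>Countable subadditivity for an arbitrary countable index set, with the sum written as a
  counting integral. The indicator of the union is at most the sum of the indicators, and the
  integrals are exchanged.\<close>

lemma emeasure_UN_le_countable:
  assumes X [measurable]: "\<And>i. i \<in> I \<Longrightarrow> X i \<in> sets M" and I [simp]: "countable I"
  shows "emeasure M (\<Union>i\<in>I. X i) \<le> (\<integral>\<^sup>+i. emeasure M (X i) \<partial>count_space I)"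
proof -
  have [measurable]: "(\<Union>i\<in>I. X i) \<in> sets M"
    by (intro sets.countable_UN') auto
  have "emeasure M (\<Union>i\<in>I. X i) = (\<integral>\<^sup>+x. indicator (\<Union>i\<in>I. X i) x \<partial>M)"
    by simp
  also have "\<dots> \<le> (\<integral>\<^sup>+x. (\<integral>\<^sup>+i. indicator (X i) x \<partial>count_space I) \<partial>M)"
  proof (intro nn_integral_mono)
    fix x
    show "indicator (\<Union>i\<in>I. X i) x \<le> (\<integral>\<^sup>+i. (indicator (X i) x :: ennreal) \<partial>count_space I)"
    proof (cases "x \<in> (\<Union>i\<in>I. X i)")
      case True
      then obtain j where j: "j \<in> I" "x \<in> X j" by blast
      then show ?thesis
        using nn_integral_ge_point[of j I "\<lambda>i. indicator (X i) x :: ennreal"] True by simp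
    qed simp
  qed
  also have "\<dots> = (\<integral>\<^sup>+i. (\<integral>\<^sup>+x. indicator (X i) x \<partial>M) \<partial>count_space I)"
    by (rule nn_integral_count_space_nn_integral) auto
  also have "\<dots> = (\<integral>\<^sup>+i. emeasure M (X i) \<partial>count_space I)"
    by (intro nn_integral_cong) simp
  finally show ?thesis .
qed

text \<open>The superlevel set is covered by balls around cubes on which the average of
  \<open>\<bar>f\<bar>\<close> exceeds \<open>t\<close>. Vitali's lemma selects disjoint balls whose
  fivefold enlargements still cover; the selected cubes are disjoint, so their masses add up to at
  most the total mass of \<open>\<bar>f\<bar>\<close>.\<close>

lemma maximal_fun_weak_type:
  fixes f :: "real ^ 'n \<Rightarrow> real"
  assumes f [measurable]: "f \<in> borel_measurable lebesgue" and t: "0 < t"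
  shows "emeasure lebesgue {x. ennreal t < maximal_fun f x} \<le>
    ennreal ((10 * real CARD('n)) ^ CARD('n) / t) * (\<integral>\<^sup>+x. ennreal \<bar>f x\<bar> \<partial>lebesgue)"
proof (cases "(\<integral>\<^sup>+x. ennreal \<bar>f x\<bar> \<partial>lebesgue) = \<infinity>")
  case True
  then show ?thesis
    using t by (simp add: ennreal_mult_top)
next
  case False
  define N where "N = CARD('n)"
  have N: "0 < N" by (simp add: N_def)
  \<comment> \<open>Integrals of \<open>\<bar>f\<bar>\<close> over cubes become values of one
    measure, additive over the disjoint family chosen later.\<close>
  define \<nu> where "\<nu> = density lebesgue (\<lambda>x. ennreal \<bar>f x\<bar>)"
  define m where "m = enn2real (\<integral>\<^sup>+x. ennreal \<bar>f x\<bar> \<partial>lebesgue)"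
  have m: "(\<integral>\<^sup>+x. ennreal \<bar>f x\<bar> \<partial>lebesgue) = ennreal m" "0 \<le> m"
    using False by (auto simp: m_def less_top ennreal_enn2real)
  define Q :: "(real ^ 'n) \<times> real \<Rightarrow> (real ^ 'n) set" where "Q = (\<lambda>(a, l). cube a l)"
  \<comment> \<open>An index is a pair of corner and side length; membership in \<open>K\<close>
    says that the average over the cube exceeds \<open>t\<close>, with the denominator
    cleared.\<close>
  define K where "K = {i. 0 < snd i \<and> ennreal (t * snd i ^ N) < emeasure \<nu> (Q i)}"
  define c where "c = (\<lambda>(a, l). (\<chi> i. a $ i + l / 2) :: real ^ 'n)"
  \<comment> \<open>By \<open>dist_cube_le\<close> this radius around the centre of the cube catches
    the whole cube.\<close>
  define r where "r = (\<lambda>i::(real ^ 'n) \<times> real. real N * snd i)"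
  have \<nu>: "emeasure \<nu> (Q i) = (\<integral>\<^sup>+y\<in>Q i. ennreal \<bar>f y\<bar> \<partial>lebesgue)" for i
    by (auto simp: \<nu>_def Q_def emeasure_density split: prod.split)
  have Qc: "Q i \<subseteq> cball (c i) (r i)" if "0 < snd i" for i
  proof
    fix x assume x: "x \<in> Q i"
    have "c i \<in> Q i"
      using that by (auto simp: Q_def c_def mem_cube split: prod.splits)
    with x have "norm (c i - x) \<le> real CARD('n) * snd i"
      by (auto simp: Q_def split: prod.splits intro: dist_cube_le)
    then show "x \<in> cball (c i) (r i)"
      by (simp add: r_def N_def dist_norm)
  qed
  have cov: "{x. ennreal t < maximal_fun f x} \<subseteq> (\<Union>i\<in>K. cball (c i) (r i))"
  proof
    fix x assume "x \<in> {x. ennreal t < maximal_fun f x}"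
    then obtain a l where l: "0 < l" "x \<in> cube a l"
      and less: "ennreal t < (\<integral>\<^sup>+y\<in>cube a l. ennreal \<bar>f y\<bar> \<partial>lebesgue) / emeasure lebesgue (cube a l)"
      by (auto simp: less_SUP_iff cubes_iff maximal_fun_def)
    have "ennreal t * ennreal (l ^ N) < (\<integral>\<^sup>+y\<in>cube a l. ennreal \<bar>f y\<bar> \<partial>lebesgue)"
      using less l unfolding emeasure_cube[OF less_imp_le[OF l(1)], of a] N_def
      by (intro less_divide_ennreal_iff[THEN iffD1]) simp_all
    then have "(a, l) \<in> K"
      using l t \<nu>[of "(a, l)"] by (simp add: K_def ennreal_mult Q_def)
    moreover have "x \<in> cball (c (a, l)) (r (a, l))"
      using Qc[of "(a, l)"] l by (auto simp: Q_def)
    ultimately show "x \<in> (\<Union>i\<in>K. cball (c i) (r i))" by blast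
  qed
  \<comment> \<open>Vitali's lemma needs bounded radii: the total mass is finite, so a cube with
    average above \<open>t\<close> cannot be too large.\<close>
  have r: "0 < r i \<and> r i \<le> real N * max 1 (m / t)" if "i \<in> K" for i
  proof -
    have l: "0 < snd i" and "ennreal (t * snd i ^ N) < emeasure \<nu> (Q i)"
      using that by (auto simp: K_def)
    moreover have "emeasure \<nu> (Q i) \<le> (\<integral>\<^sup>+x. ennreal \<bar>f x\<bar> \<partial>lebesgue)"
      unfolding \<nu> by (intro nn_integral_mono) (auto simp: indicator_def)
    ultimately have "ennreal (t * snd i ^ N) \<le> ennreal m"
      unfolding m by (meson order_less_imp_le order_trans)
    then have "t * snd i ^ N \<le> m"
      using m by (simp add: ennreal_le_iff)
    then have "snd i ^ N \<le> m / t"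
      using m t by (simp add: field_simps)
    moreover have "snd i \<le> max 1 (snd i ^ N)"
      using l N self_le_power[of "snd i" N] by (cases "1 \<le> snd i") auto
    ultimately have "snd i \<le> max 1 (m / t)"
      by auto
    then show ?thesis
      using l N by (auto simp: r_def intro!: mult_left_mono)
  qed
  obtain C where C: "countable C" "C \<subseteq> K"
     "pairwise (\<lambda>i j. disjnt (cball (c i) (r i)) (cball (c j) (r j))) C"
     "{x. ennreal t < maximal_fun f x} \<subseteq> (\<Union>i\<in>C. cball (c i) (5 * r i))"
    using Vitali_covering_lemma_cballs[OF cov r] by blast
  define A where "A = (10 * real N) ^ N / t"
  have ball: "emeasure lebesgue (cball (c i) (5 * r i)) \<le> ennreal A * emeasure \<nu> (Q i)" if "i \<in> C" for i
  proof -
    have i: "0 < snd i" "ennreal (t * snd i ^ N) < emeasure \<nu> (Q i)"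
      using that C by (auto simp: K_def)
    \<comment> \<open>The enlarged ball fits into a cube of side \<open>10 * r i\<close>, that is 10
      n times the original side. This is where the constant of the weak type bound comes
      from.\<close>
    have "cball (c i) (5 * r i) \<subseteq> cube (\<chi> j. c i $ j - 5 * r i) (10 * r i)"
    proof
      fix x assume "x \<in> cball (c i) (5 * r i)"
      then have n: "norm (c i - x) \<le> 5 * r i"
        by (simp add: dist_norm)
      have "\<bar>c i $ j - x $ j\<bar> \<le> 5 * r i" for j
        using order_trans[OF component_le_norm_cart[of "c i - x" j] n] by simp
      then show "x \<in> cube (\<chi> j. c i $ j - 5 * r i) (10 * r i)"
        by (auto simp: mem_cube abs_le_iff, smt+)
    qed
    then have "emeasure lebesgue (cball (c i) (5 * r i)) \<le> emeasure lebesgue (cube (\<chi> j. c i $ j - 5 * r i) (10 * r i))"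
      by (intro emeasure_mono) auto
    also have "\<dots> = ennreal ((10 * r i) ^ N)"
      unfolding N_def using i by (intro emeasure_cube) (simp add: r_def)
    also have "(10 * r i) ^ N = A * (t * snd i ^ N)"
      using t by (simp add: A_def r_def power_mult_distrib)
    also have "ennreal (A * (t * snd i ^ N)) = ennreal A * ennreal (t * snd i ^ N)"
      using t i by (intro ennreal_mult) (auto simp: A_def)
    also have "\<dots> \<le> ennreal A * emeasure \<nu> (Q i)"
      using i by (intro mult_left_mono) auto
    finally show ?thesis .
  qed
  have disj: "disjoint_family_on Q C"
    unfolding disjoint_family_on_def
  proof (intro ballI impI)
    fix i j assume ij: "i \<in> C" "j \<in> C" "i \<noteq> j"
    then have "disjnt (cball (c i) (r i)) (cball (c j) (r j))"
      using C(3) by (auto simp: pairwise_def)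
    moreover have "Q i \<subseteq> cball (c i) (r i)" "Q j \<subseteq> cball (c j) (r j)"
      using ij C(2) by (auto intro!: Qc simp: K_def)
    ultimately show "Q i \<inter> Q j = {}"
      by (auto simp: disjnt_def)
  qed
  have Qs: "Q i \<in> sets lebesgue" for i
    by (simp add: Q_def split: prod.split)
  have "emeasure lebesgue {x. ennreal t < maximal_fun f x} \<le> emeasure lebesgue (\<Union>i\<in>C. cball (c i) (5 * r i))"
    using C by (intro emeasure_mono sets.countable_UN') auto
  also have "\<dots> \<le> (\<integral>\<^sup>+i. emeasure lebesgue (cball (c i) (5 * r i)) \<partial>count_space C)"
    using C by (intro emeasure_UN_le_countable) auto
  also have "\<dots> \<le> (\<integral>\<^sup>+i. ennreal A * emeasure \<nu> (Q i) \<partial>count_space C)"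
    by (intro nn_integral_mono ball) simp
  also have "\<dots> = ennreal A * (\<integral>\<^sup>+i. emeasure \<nu> (Q i) \<partial>count_space C)"
    by (intro nn_integral_cmult) auto
  also have "(\<integral>\<^sup>+i. emeasure \<nu> (Q i) \<partial>count_space C) = emeasure \<nu> (\<Union>i\<in>C. Q i)"
    using C disj Qs by (intro emeasure_UN_countable[symmetric]) (auto simp: \<nu>_def)
  also have "\<dots> \<le> emeasure \<nu> (space \<nu>)"
    by (rule emeasure_space)
  also have "\<dots> = (\<integral>\<^sup>+x. ennreal \<bar>f x\<bar> \<partial>lebesgue)"
    by (simp add: \<nu>_def emeasure_density)
  finally show ?thesis
    by (simp add: A_def N_def mult_left_mono)
qed

text \<open>Integrating \<open>2 * t\<close> up to a real \<open>r \<le> y\<close> gives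
  \<open>r * r\<close>. The bound is first shown for all such \<open>r\<close>, not only for
  \<open>r = y\<close>, so that it also forces the integral to be infinite when \<open>y\<close>
  is.\<close>

lemma ennreal_square_le_layer_cake:
  fixes y :: ennreal
  shows "y * y \<le> (\<integral>\<^sup>+t. ennreal (2 * t) * indicator {t. 0 < t \<and> ennreal t < y} t \<partial>lborel)"
    (is "_ \<le> ?I y")
proof -
  have real: "ennreal (r * r) \<le> ?I y" if r: "0 \<le> r" "ennreal r \<le> y" for r
  proof -
    have "ennreal (r * r) = (\<integral>\<^sup>+t. ennreal (2 * t) * indicator {0..r} t \<partial>lborel)"
      using r by (subst nn_integral_FTC_Icc[where F = "\<lambda>t. t * t"]) (auto intro!: derivative_eq_intros)
    also have "\<dots> \<le> ?I y"
    proof (intro nn_integral_mono_AE)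
      \<comment> \<open>The closed interval contains the endpoint \<open>r\<close>, where the strict
        condition fails if \<open>y = ennreal r\<close>.\<close>
      have "AE t in lborel. t \<noteq> r"
        by (rule AE_lborel_singleton)
      then show "AE t in lborel. ennreal (2 * t) * indicator {0..r} t \<le>
          ennreal (2 * t) * indicator {t. 0 < t \<and> ennreal t < y} t"
      proof eventually_elim
        case (elim t)
        show ?case
        proof (cases "0 < t \<and> t < r")
          case True
          then have "ennreal t < ennreal r" by (simp add: ennreal_less_iff)
          with True r show ?thesis by auto
        next
          case False
          with elim show ?thesis by (auto simp: indicator_def ennreal_neg)
        qed
      qed
    qed
    finally show ?thesis .
  qed
  show ?thesis
  proof (cases y)
    case (real r)
    then show ?thesis
      using \<open>\<And>r. 0 \<le> r \<Longrightarrow> ennreal r \<le> y \<Longrightarrow> ennreal (r * r) \<le> ?I y\<close>[of r] by (simp add: ennreal_mult)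
  next
    case top
    have nat: "of_nat k \<le> ?I y" for k :: nat
    proof -
      have "ennreal (real k) \<le> ennreal (real k * real k)"
        by (intro ennreal_leI) (metis of_nat_0_le_iff of_nat_le_iff of_nat_mult le_square)
      also have "\<dots> \<le> ?I y"
        by (rule real) (auto simp: top)
      finally show ?thesis
        by (simp add: ennreal_of_nat_eq_real_of_nat)
    qed
    have "(SUP k. of_nat k) \<le> ?I y"
      by (rule SUP_least) (rule nat)
    then show ?thesis
      by (simp add: ennreal_SUP_of_nat_eq_top top_unique)
  qed
qed

text \<open>Marcinkiewicz interpolation between the weak type bound and the trivial supremum bound:
  at height \<open>t\<close> only the part \<open>h\<close> of \<open>f\<close> above
  \<open>t / 2\<close> matters. Integrating over all heights and exchanging integrals gives the
  square. With \<open>f\<close> Borel, the exchange takes place over the product of Borel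
  sigma-algebras.\<close>

lemma maximal_fun_L2_borel:
  fixes f :: "real ^ 'n \<Rightarrow> real"
  assumes f [measurable]: "f \<in> borel_measurable borel"
  shows "(\<integral>\<^sup>+x. maximal_fun f x * maximal_fun f x \<partial>lborel) \<le>
    ennreal (8 * (10 * real CARD('n)) ^ CARD('n)) * (\<integral>\<^sup>+x. ennreal (\<bar>f x\<bar> * \<bar>f x\<bar>) \<partial>lborel)"
proof -
  define A where "A = (10 * real CARD('n)) ^ CARD('n)"
  have A: "0 \<le> A" by (simp add: A_def)
  note [measurable] = borel_measurable_maximal_fun[of f]
  have level: "emeasure lborel {x. ennreal t < maximal_fun f x} \<le>
      ennreal (2 * A / t) * (\<integral>\<^sup>+x. ennreal \<bar>f x\<bar> * indicator {x. t < 2 * \<bar>f x\<bar>} x \<partial>lborel)" if t: "0 < t" for t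
  proof -
    define h where "h = (\<lambda>x. f x * indicator {x. t < 2 * \<bar>f x\<bar>} x)"
    have [measurable]: "h \<in> borel_measurable borel"
      unfolding h_def by measurable
    then have [measurable]: "h \<in> borel_measurable lebesgue"
      by (simp add: measurable_completion)
    \<comment> \<open>Where \<open>h\<close> differs from \<open>f\<close>, the latter is at most
      \<open>t / 2\<close> in absolute value and adds at most \<open>t / 2\<close> to any
      average.\<close>
    have "maximal_fun f x \<le> maximal_fun h x + ennreal (t / 2)" for x
      unfolding maximal_fun_def[of f]
    proof (rule SUP_least)
      fix Q assume "Q \<in> {Q \<in> cubes. x \<in> Q}"
      then obtain a l where Q: "Q = cube a l" "0 < l" "x \<in> cube a l"
        by (auto simp: cubes_iff)
      have "(\<integral>\<^sup>+y\<in>Q. ennreal \<bar>f y\<bar> \<partial>lebesgue) \<le>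
          (\<integral>\<^sup>+y. ennreal \<bar>h y\<bar> * indicator Q y + ennreal (t / 2) * indicator Q y \<partial>lebesgue)"
        using t by (intro nn_integral_mono)
          (auto simp: h_def indicator_def ennreal_plus[symmetric] simp del: ennreal_plus intro!: ennreal_leI)
      also have "\<dots> = (\<integral>\<^sup>+y\<in>Q. ennreal \<bar>h y\<bar> \<partial>lebesgue) + ennreal (t / 2) * emeasure lebesgue Q"
        unfolding Q by (subst nn_integral_add) (auto simp: nn_integral_cmult_indicator)
      also have "\<dots> \<le> maximal_fun h x * emeasure lebesgue Q + ennreal (t / 2) * emeasure lebesgue Q"
        unfolding Q using Q by (intro add_right_mono avg_le_maximal_fun)
      also have "\<dots> = (maximal_fun h x + ennreal (t / 2)) * emeasure lebesgue Q"
        by (simp add: distrib_right)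
      finally show "(\<integral>\<^sup>+y\<in>Q. ennreal \<bar>f y\<bar> \<partial>lebesgue) / emeasure lebesgue Q \<le> maximal_fun h x + ennreal (t / 2)"
        unfolding Q emeasure_cube[OF less_imp_le[OF Q(2)], of a] 
        using Q(2) by (intro divide_le_ennreal_iff[THEN iffD2]) simp_all
    qed
    then have "{x. ennreal t < maximal_fun f x} \<subseteq> {x. ennreal (t / 2) < maximal_fun h x}"
    proof (intro subsetI CollectI)
      fix x assume "x \<in> {x. ennreal t < maximal_fun f x}"
      then have "ennreal t < maximal_fun h x + ennreal (t / 2)"
        using \<open>\<And>x. maximal_fun f x \<le> maximal_fun h x + ennreal (t / 2)\<close>[of x] by auto
      moreover have "ennreal t = ennreal (t / 2) + ennreal (t / 2)"
        using t by (simp add: ennreal_plus[symmetric] del: ennreal_plus)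
      ultimately show "ennreal (t / 2) < maximal_fun h x"
        by (metis add_right_mono not_le)
    qed
    note [measurable] = borel_measurable_maximal_fun[of h]
    from \<open>{x. ennreal t < maximal_fun f x} \<subseteq> {x. ennreal (t / 2) < maximal_fun h x}\<close>
    have "emeasure lborel {x. ennreal t < maximal_fun f x} \<le> emeasure lborel {x. ennreal (t / 2) < maximal_fun h x}"
      by (intro emeasure_mono) measurable
    also have "\<dots> = emeasure lebesgue {x. ennreal (t / 2) < maximal_fun h x}"
      by simp
    also have "\<dots> \<le> ennreal (A / (t / 2)) * (\<integral>\<^sup>+x. ennreal \<bar>h x\<bar> \<partial>lebesgue)"
      unfolding A_def using t by (intro maximal_fun_weak_type) (auto intro: measurable_completion)
    also have "(\<integral>\<^sup>+x. ennreal \<bar>h x\<bar> \<partial>lebesgue) = (\<integral>\<^sup>+x. ennreal \<bar>f x\<bar> * indicator {x. t < 2 * \<bar>f x\<bar>} x \<partial>lborel)"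
      unfolding nn_integral_completion by (intro nn_integral_cong) (auto simp: h_def indicator_def)
    finally show ?thesis by (simp add: mult.commute)
  qed
  have "(\<integral>\<^sup>+x. maximal_fun f x * maximal_fun f x \<partial>lborel) \<le>
      (\<integral>\<^sup>+x. (\<integral>\<^sup>+t. ennreal (2 * t) * indicator {t. 0 < t \<and> ennreal t < maximal_fun f x} t \<partial>lborel) \<partial>lborel)"
    by (intro nn_integral_mono ennreal_square_le_layer_cake)
  also have "\<dots> = (\<integral>\<^sup>+x. (\<integral>\<^sup>+t. ennreal (2 * t) * indicator {p. 0 < snd p \<and> ennreal (snd p) < maximal_fun f (fst p)} (x, t) \<partial>lborel) \<partial>lborel)"
    by (intro nn_integral_cong) (simp add: indicator_def)
  also have "\<dots> = (\<integral>\<^sup>+t. (\<integral>\<^sup>+x. ennreal (2 * t) * indicator {p. 0 < snd p \<and> ennreal (snd p) < maximal_fun f (fst p)} (x, t) \<partial>lborel) \<partial>(lborel::real measure))"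
    by (rule lborel_pair.Fubini'[symmetric]) measurable
  also have "\<dots> = (\<integral>\<^sup>+t. ennreal (2 * t) * (indicator {0<..} t * emeasure lborel {x. ennreal t < maximal_fun f x}) \<partial>lborel)"
  proof (intro nn_integral_cong)
    fix t :: real
    have "(\<integral>\<^sup>+x. ennreal (2 * t) * indicator {p. 0 < snd p \<and> ennreal (snd p) < maximal_fun f (fst p)} (x, t) \<partial>lborel) =
        (\<integral>\<^sup>+x. (ennreal (2 * t) * indicator {0<..} t) * indicator {x. ennreal t < maximal_fun f x} x \<partial>lborel)"
      by (intro nn_integral_cong) (auto simp: indicator_def)
    also have "\<dots> = (ennreal (2 * t) * indicator {0<..} t) * emeasure lborel {x. ennreal t < maximal_fun f x}"
      by (rule nn_integral_cmult_indicator) measurable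
    finally show "(\<integral>\<^sup>+x. ennreal (2 * t) * indicator {p. 0 < snd p \<and> ennreal (snd p) < maximal_fun f (fst p)} (x, t) \<partial>lborel) =
       ennreal (2 * t) * (indicator {0<..} t * emeasure lborel {x. ennreal t < maximal_fun f x})"
      by (simp add: mult.assoc)
  qed
  \<comment> \<open>The weight \<open>2 * t\<close> cancels the \<open>1 / t\<close> of the weak
    type bound: \<open>2 * t * (2 * A / t) = 4 * A\<close>.\<close>
  also have "\<dots> \<le> (\<integral>\<^sup>+t. ennreal (4 * A) * (\<integral>\<^sup>+x. ennreal \<bar>f x\<bar> * indicator {p. 0 < snd p \<and> snd p < 2 * \<bar>f (fst p)\<bar>} (x, t) \<partial>lborel) \<partial>lborel)"
  proof (intro nn_integral_mono)
    fix t :: real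
    show "ennreal (2 * t) * (indicator {0<..} t * emeasure lborel {x. ennreal t < maximal_fun f x}) \<le>
      ennreal (4 * A) * (\<integral>\<^sup>+x. ennreal \<bar>f x\<bar> * indicator {p. 0 < snd p \<and> snd p < 2 * \<bar>f (fst p)\<bar>} (x, t) \<partial>lborel)"
    proof (cases "0 < t")
      case True
      have "ennreal (2 * t) * emeasure lborel {x. ennreal t < maximal_fun f x} \<le>
         ennreal (2 * t) * (ennreal (2 * A / t) * (\<integral>\<^sup>+x. ennreal \<bar>f x\<bar> * indicator {x. t < 2 * \<bar>f x\<bar>} x \<partial>lborel))"
        by (intro mult_left_mono level True) simp
      also have "\<dots> = ennreal (4 * A) * (\<integral>\<^sup>+x. ennreal \<bar>f x\<bar> * indicator {x. t < 2 * \<bar>f x\<bar>} x \<partial>lborel)"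
        unfolding mult.assoc[symmetric] using True A by (subst ennreal_mult[symmetric]) auto
      finally show ?thesis
        using True by (simp add: indicator_def)
    qed simp
  qed
  also have "\<dots> = ennreal (4 * A) * (\<integral>\<^sup>+t. (\<integral>\<^sup>+x. ennreal \<bar>f x\<bar> * indicator {p. 0 < snd p \<and> snd p < 2 * \<bar>f (fst p)\<bar>} (x, t) \<partial>lborel) \<partial>lborel)"
    by (intro nn_integral_cmult) measurable
  also have "(\<integral>\<^sup>+t. (\<integral>\<^sup>+x. ennreal \<bar>f x\<bar> * indicator {p. 0 < snd p \<and> snd p < 2 * \<bar>f (fst p)\<bar>} (x, t) \<partial>lborel) \<partial>(lborel::real measure))
     = (\<integral>\<^sup>+x. (\<integral>\<^sup>+t. ennreal \<bar>f x\<bar> * indicator {p. 0 < snd p \<and> snd p < 2 * \<bar>f (fst p)\<bar>} (x, t) \<partial>lborel) \<partial>lborel)"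
    by (rule lborel_pair.Fubini') measurable
  \<comment> \<open>For fixed \<open>x\<close> the heights fill an interval of length
    \<open>2 * \<bar>f x\<bar>\<close>; this second factor 2 turns \<open>4 * A\<close> into
    \<open>8 * A\<close>.\<close>
  also have "\<dots> = (\<integral>\<^sup>+x. ennreal 2 * ennreal (\<bar>f x\<bar> * \<bar>f x\<bar>) \<partial>lborel)"
  proof (intro nn_integral_cong)
    fix x
    have "(\<integral>\<^sup>+t. ennreal \<bar>f x\<bar> * indicator {p. 0 < snd p \<and> snd p < 2 * \<bar>f (fst p)\<bar>} (x, t) \<partial>lborel) =
       (\<integral>\<^sup>+t. ennreal \<bar>f x\<bar> * indicator {0<..<2 * \<bar>f x\<bar>} t \<partial>lborel)"
      by (intro nn_integral_cong) (auto simp: indicator_def)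
    also have "\<dots> = ennreal \<bar>f x\<bar> * ennreal (2 * \<bar>f x\<bar>)"
      by (subst nn_integral_cmult_indicator) auto
    also have "\<dots> = ennreal 2 * ennreal (\<bar>f x\<bar> * \<bar>f x\<bar>)"
      by (simp add: ennreal_mult[symmetric] mult_ac del: ennreal_numeral)
    finally show "(\<integral>\<^sup>+t. ennreal \<bar>f x\<bar> * indicator {p. 0 < snd p \<and> snd p < 2 * \<bar>f (fst p)\<bar>} (x, t) \<partial>lborel) =
      ennreal 2 * ennreal (\<bar>f x\<bar> * \<bar>f x\<bar>)" .
  qed
  also have "ennreal (4 * A) * \<dots> = ennreal (8 * A) * (\<integral>\<^sup>+x. ennreal (\<bar>f x\<bar> * \<bar>f x\<bar>) \<partial>lborel)"
    using A by (subst nn_integral_cmult) (auto simp: mult.assoc[symmetric] ennreal_mult[symmetric] simp del: ennreal_numeral)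
  finally show ?thesis
    by (simp add: A_def)
qed

text \<open>A Borel function equal to \<open>f\<close> almost everywhere has the same averages,
  hence the same maximal function.\<close>

lemma maximal_fun_L2:
  fixes f :: "real ^ 'n \<Rightarrow> real"
  assumes f: "f \<in> borel_measurable lebesgue"
  shows "(\<integral>\<^sup>+x. maximal_fun f x * maximal_fun f x \<partial>lebesgue) \<le>
    ennreal (8 * (10 * real CARD('n)) ^ CARD('n)) * (\<integral>\<^sup>+x. ennreal (\<bar>f x\<bar> * \<bar>f x\<bar>) \<partial>lebesgue)"
proof -
  obtain g where g: "g \<in> borel_measurable borel" "AE x in lborel. f x = g x"
    using completion_ex_borel_measurable_real[OF f] by auto
  have "maximal_fun f = maximal_fun g"
    using AE_completion[OF g(2)] by (intro maximal_fun_cong_AE) auto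
  moreover have "(\<integral>\<^sup>+x. ennreal (\<bar>f x\<bar> * \<bar>f x\<bar>) \<partial>lborel) = (\<integral>\<^sup>+x. ennreal (\<bar>g x\<bar> * \<bar>g x\<bar>) \<partial>lborel)"
    using g(2) by (intro nn_integral_cong_AE) auto
  ultimately show ?thesis
    using maximal_fun_L2_borel[OF g(1)] unfolding nn_integral_completion by simp
qed

section \<open>Transfer of boundedness from the maximal function\<close>

lemma weighted_AM_GM:
  fixes x y e :: real
  assumes "0 \<le> x" "0 \<le> y" "0 < e" "e < 1"
  shows "x powr e * y powr (1 - e) \<le> e * x + (1 - e) * y"
  using assms Youngs_inequality_0[of e "1 - e" x y] by (cases "x = 0 \<or> y = 0") auto

text \<open>The weighted mean inequality is applied pointwise to \<open>G x / a\<close> and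
  \<open>w x / b\<close> and integrated. Positive real bounds \<open>a\<close> and \<open>b\<close>
  stand for the integrals, so that the normalisation also makes sense when an integral
  vanishes.\<close>

lemma nn_integral_Holder:
  fixes G w :: "'a \<Rightarrow> real"
  assumes [measurable]: "G \<in> borel_measurable M" "w \<in> borel_measurable M" "Q \<in> sets M"
    and e: "0 < e" "e < 1" and ab: "0 < a" "0 < b"
    and nn: "\<And>x. 0 \<le> G x" "\<And>x. 0 \<le> w x"
    and G: "(\<integral>\<^sup>+x\<in>Q. ennreal (G x) \<partial>M) \<le> ennreal a"
    and w: "(\<integral>\<^sup>+x\<in>Q. ennreal (w x) \<partial>M) \<le> ennreal b"
  shows "(\<integral>\<^sup>+x\<in>Q. ennreal (G x powr e * w x powr (1 - e)) \<partial>M) \<le> ennreal (a powr e * b powr (1 - e))"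
proof -
  define k where "k = a powr e * b powr (1 - e)"
  have k: "0 < k" using ab by (simp add: k_def)
  have "(\<integral>\<^sup>+x\<in>Q. ennreal (G x powr e * w x powr (1 - e)) \<partial>M) \<le>
      (\<integral>\<^sup>+x. ennreal (k * e / a) * (ennreal (G x) * indicator Q x) +
         ennreal (k * (1 - e) / b) * (ennreal (w x) * indicator Q x) \<partial>M)"
  proof (intro nn_integral_mono)
    fix x
    have "G x powr e * w x powr (1 - e) = k * ((G x / a) powr e * (w x / b) powr (1 - e))"
      using nn ab by (simp add: k_def powr_divide)
    also have "\<dots> \<le> k * (e * (G x / a) + (1 - e) * (w x / b))"
      using nn[of x] ab k e by (intro mult_left_mono weighted_AM_GM) auto
    also have "\<dots> = (k * e / a) * G x + (k * (1 - e) / b) * w x"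
      by (simp add: algebra_simps)
    finally show "ennreal (G x powr e * w x powr (1 - e)) * indicator Q x \<le>
      ennreal (k * e / a) * (ennreal (G x) * indicator Q x) +
         ennreal (k * (1 - e) / b) * (ennreal (w x) * indicator Q x)"
      using nn[of x] ab k e
      by (auto simp: indicator_def ennreal_mult[symmetric] ennreal_plus[symmetric] simp del: ennreal_plus intro!: ennreal_leI)
  qed
  also have "\<dots> = ennreal (k * e / a) * (\<integral>\<^sup>+x\<in>Q. ennreal (G x) \<partial>M) + ennreal (k * (1 - e) / b) * (\<integral>\<^sup>+x\<in>Q. ennreal (w x) \<partial>M)"
    by (subst nn_integral_add) (auto simp: nn_integral_cmult)
  also have "\<dots> \<le> ennreal (k * e / a) * ennreal a + ennreal (k * (1 - e) / b) * ennreal b"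
    by (intro add_mono mult_left_mono G w) auto
  also have "\<dots> = ennreal (k * e + k * (1 - e))"
    using ab k e by (simp add: ennreal_mult[symmetric] ennreal_plus[symmetric] del: ennreal_plus)
  also have "k * e + k * (1 - e) = a powr e * b powr (1 - e)"
    by (simp add: k_def algebra_simps)
  finally show ?thesis .
qed

text \<open>The right-hand side is right-continuous in \<open>A\<close> at \<open>r\<close>, at
  \<open>r = 0\<close> because \<open>e\<close> is positive. This recovers an estimate by the
  maximal function itself from estimates by its positive upper bounds, including points where it
  vanishes.\<close>

lemma le_powr_if_le_all_greater:
  fixes X :: ennreal
  assumes "0 \<le> r" "0 < e" "0 \<le> k" and le: "\<And>A. r < A \<Longrightarrow> X \<le> ennreal (k * A powr e)"
  shows "X \<le> ennreal (k * r powr e)"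
proof -
  have "((\<lambda>A. ennreal (k * A powr e)) \<longlongrightarrow> ennreal (k * r powr e)) (at_right r)"
    using assms by (intro tendsto_ennrealI tendsto_mult tendsto_const tendsto_powr' tendsto_ident_at)
      (auto intro!: eventually_mono[OF eventually_at_right_less])
  then show ?thesis
    by (rule tendsto_lowerbound) (use eventually_mono[OF eventually_at_right_less le] in simp_all)
qed

lemma exponents_P_scale:
  assumes "s \<in> exponents_P" "1 \<le> c"
  shows "(\<lambda>x. c * s x) \<in> exponents_P"
proof -
  have s: "s \<in> variable_exponents" "1 < exp_minus s" "exp_plus s < \<infinity>"
    using assms(1) by (auto simp: exponents_P_def)
  note [measurable] = variable_exponents_measurable[OF s(1)]
  have ge: "s x \<le> c * s x" for x
    using assms(2) variable_exponents_ge_1[OF s(1), of x] mult_right_mono[of 1 c "s x"] by simp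
  have ve: "(\<lambda>x. c * s x) \<in> variable_exponents"
    using ge variable_exponents_ge_1[OF s(1)] by (auto simp: variable_exponents_def intro: order_trans)
  have "exp_minus s \<le> exp_minus (\<lambda>x. c * s x)"
    unfolding exp_minus_def
    by (intro Sup_subset_mono) (auto elim!: eventually_mono intro: order_trans[OF _ ereal_less_eq(3)[THEN iffD2, OF ge]])
  moreover have "exp_plus (\<lambda>x. c * s x) < \<infinity>"
  proof -
    have "exp_plus (\<lambda>x. c * s x) = ereal c * exp_plus s"
      unfolding exp_plus_def times_ereal.simps(1)[symmetric] using assms(2) by (intro esssup_cmult) auto
    then show ?thesis
      using s(3) assms(2) by (cases "exp_plus s") auto
  qed
  ultimately show ?thesis
    using ve s(2) by (auto simp: exponents_P_def)
qed

text \<open>The common mechanism for powers of exponents and for commutators: \<open>T f\<close> is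
  dominated by \<open>k * t\<close> times the \<open>e\<close>-th power of the maximal function of
  some \<open>G\<close> in the modular unit ball of exponent \<open>s\<close>. Since
  \<open>e * q x = s x\<close>, the \<open>q\<close>-modular of that power is the
  \<open>s\<close>-modular of the maximal function. The domination is phrased with real
  \<open>A > 0\<close> to keep powers within the reals.\<close>

lemma bounded_operator_by_maximal_fun:
  fixes s p q :: "real ^ 'n \<Rightarrow> real"
  assumes s: "s \<in> exponents_B" and p: "p \<in> variable_exponents" and q: "q \<in> variable_exponents"
    and e: "0 < e" and qs: "\<And>x. e * q x = s x" and k: "0 < k"
    and T: "\<And>f t. f \<in> borel_measurable lebesgue \<Longrightarrow> 0 < t \<Longrightarrow> modular p (\<lambda>x. f x / t) \<le> 1 \<Longrightarrow>
      (\<lambda>x. enn2real (T f x)) \<in> borel_measurable lebesgue \<and>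
      (\<exists>G\<in>borel_measurable lebesgue. modular s G \<le> 1 \<and>
         (AE x in lebesgue. \<forall>A>0. maximal_fun G x \<le> ennreal A \<longrightarrow> T f x \<le> ennreal (k * t * A powr e)))"
  shows "bounded_operator T p q"
proof -
  have sv: "s \<in> variable_exponents" and Ms: "bounded_operator maximal_fun s s"
    using s by (auto simp: exponents_B_def exponents_P_def)
  obtain C where C: "0 < C" "\<And>G. G \<in> borel_measurable lebesgue \<Longrightarrow> modular s G \<le> 1 \<Longrightarrow>
       (AE x in lebesgue. maximal_fun G x < \<infinity>) \<and>
       modular s (\<lambda>x. enn2real (maximal_fun G x) / C) \<le> 1"
  proof -
    from Ms[unfolded bounded_operator_iff_modular[OF sv sv]] obtain C where C: "C>0" and
      *: "\<forall>f\<in>borel_measurable lebesgue. \<forall>t>0. modular s (\<lambda>x. f x / t) \<le> 1 \<longrightarrow>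
       (AE x in lebesgue. maximal_fun f x < \<infinity>) \<and> (\<lambda>x. enn2real (maximal_fun f x)) \<in> borel_measurable lebesgue \<and>
       modular s (\<lambda>x. enn2real (maximal_fun f x) / (C * t)) \<le> 1" by blast
    have "(AE x in lebesgue. maximal_fun G x < \<infinity>) \<and>
       modular s (\<lambda>x. enn2real (maximal_fun G x) / C) \<le> 1"
      if "G \<in> borel_measurable lebesgue" "modular s G \<le> 1" for G
      using *[rule_format, OF that(1) zero_less_one] that(2) by simp
    with C that show ?thesis by blast
  qed
  show ?thesis
    unfolding bounded_operator_iff_modular[OF p q]
  \<comment> \<open>If \<open>C\<close> is the constant for the maximal function at exponent
    \<open>s\<close>, taking the \<open>e\<close>-th power turns it into
    \<open>C powr e\<close>.\<close>
  proof (intro exI[of _ "k * C powr e"] conjI ballI allI impI)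
    show "0 < k * C powr e" using k C by simp
    fix f :: "real ^ 'n \<Rightarrow> real" and t :: real
    assume f: "f \<in> borel_measurable lebesgue" and t: "0 < t" and m: "modular p (\<lambda>x. f x / t) \<le> 1"
    show "(\<lambda>x. enn2real (T f x)) \<in> borel_measurable lebesgue"
      using T[OF f t m] by blast
    obtain G where G: "G \<in> borel_measurable lebesgue" "modular s G \<le> 1"
      "AE x in lebesgue. \<forall>A>0. maximal_fun G x \<le> ennreal A \<longrightarrow> T f x \<le> ennreal (k * t * A powr e)"
      using T[OF f t m] by blast
    note CG = C(2)[OF G(1,2)]
    have le: "AE x in lebesgue. T f x \<le> ennreal (k * t * enn2real (maximal_fun G x) powr e)"
      using CG[THEN conjunct1] G(3)
    proof eventually_elim
      case (elim x)
      show ?case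
      proof (rule le_powr_if_le_all_greater)
        fix A assume A: "enn2real (maximal_fun G x) < A"
        then have "0 < A"
          using enn2real_nonneg[of "maximal_fun G x"] by linarith
        moreover have "maximal_fun G x \<le> ennreal A"
          using A elim(1) by (metis ennreal_enn2real_if ennreal_leI infinity_ennreal_def less_imp_le less_irrefl)
        ultimately show "T f x \<le> ennreal (k * t * A powr e)"
          using elim(2) by blast
      qed (use k t e in auto)
    qed
    then show "AE x in lebesgue. T f x < \<infinity>"
      by eventually_elim (auto simp: less_top intro: le_less_trans)
    have "modular q (\<lambda>x. enn2real (T f x) / (k * C powr e * t)) \<le> modular s (\<lambda>x. enn2real (maximal_fun G x) / C)"
      unfolding modular_def
    proof (rule nn_integral_mono_AE)
      show "AE x in lebesgue. ennreal (\<bar>enn2real (T f x) / (k * C powr e * t)\<bar> powr q x) \<le>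
         ennreal (\<bar>enn2real (maximal_fun G x) / C\<bar> powr s x)"
        using le
      proof eventually_elim
        case (elim x)
        define r where "r = enn2real (maximal_fun G x)"
        have r: "0 \<le> r" by (simp add: r_def)
        have "enn2real (T f x) \<le> k * t * r powr e"
          using elim k t unfolding r_def by (intro enn2real_leI) auto
        then have "enn2real (T f x) / (k * C powr e * t) \<le> (r / C) powr e"
          using k t C(1) r by (simp add: field_simps powr_divide)
        then have "\<bar>enn2real (T f x) / (k * C powr e * t)\<bar> \<le> (r / C) powr e"
          using k t by simp
        then have "\<bar>enn2real (T f x) / (k * C powr e * t)\<bar> powr q x \<le> ((r / C) powr e) powr q x"
          using variable_exponents_ge_1[OF q, of x] by (intro powr_mono2) auto
        also have "\<dots> = \<bar>r / C\<bar> powr s x"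
          using r C(1) by (simp add: powr_powr qs)
        finally show ?case
          by (simp add: r_def ennreal_leI)
      qed
    qed
    then show "modular q (\<lambda>x. enn2real (T f x) / (k * C powr e * t)) \<le> 1"
      using CG by (auto intro: order_trans)
  qed
qed

text \<open>On each cube, Hoelder's inequality against the constant function 1 bounds the average of
  \<open>\<bar>f\<bar>\<close> by the \<open>1 / c\<close>-th power of the average of
  \<open>\<bar>f\<bar> powr c\<close>. The transfer lemma is used with
  \<open>e = 1 / c\<close>.\<close>

lemma exponents_B_scale:
  fixes s :: "real ^ 'n \<Rightarrow> real"
  assumes s: "s \<in> exponents_B" and c: "1 < c"
  shows "(\<lambda>x. c * s x) \<in> exponents_B"
proof -
  have sP: "s \<in> exponents_P" and sv: "s \<in> variable_exponents"
    using s by (auto simp: exponents_B_def exponents_P_def)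
  have csP: "(\<lambda>x. c * s x) \<in> exponents_P"
    using exponents_P_scale[OF sP] c by simp
  then have csv: "(\<lambda>x. c * s x) \<in> variable_exponents"
    by (simp add: exponents_P_def)
  have "bounded_operator maximal_fun (\<lambda>x. c * s x) (\<lambda>x. c * s x)"
  proof (rule bounded_operator_by_maximal_fun[OF s csv csv, where e = "1 / c" and k = 1])
    fix f :: "real ^ 'n \<Rightarrow> real" and t :: real
    assume [measurable]: "f \<in> borel_measurable lebesgue" and t: "0 < t"
      and m: "modular (\<lambda>x. c * s x) (\<lambda>x. f x / t) \<le> 1"
    \<comment> \<open>The \<open>s\<close>-modular of this function is the modular of
      \<open>f / t\<close> for the exponent \<open>c * s x\<close>.\<close>
    define G where "G = (\<lambda>x. \<bar>f x / t\<bar> powr c)"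
    have [measurable]: "G \<in> borel_measurable lebesgue"
      unfolding G_def by measurable
    have "modular s G \<le> 1"
      using m by (simp add: modular_def G_def powr_powr)
    moreover have "maximal_fun f x \<le> ennreal (1 * t * A powr (1 / c))"
      if A: "0 < A" "maximal_fun G x \<le> ennreal A" for x A
      unfolding maximal_fun_def
    proof (rule SUP_least)
      fix Q assume "Q \<in> {Q \<in> cubes. x \<in> Q}"
      then obtain a l where Q: "Q = cube a l" "0 < l" "x \<in> cube a l"
        by (auto simp: cubes_iff)
      define v where "v = l ^ CARD('n)"
      have v: "0 < v" "emeasure lebesgue Q = ennreal v"
        using Q emeasure_cube[of l a] by (simp_all add: v_def del: emeasure_completion)
      have "(\<integral>\<^sup>+y\<in>Q. ennreal (G y) \<partial>lebesgue) \<le> maximal_fun G x * emeasure lebesgue Q"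
        using avg_le_maximal_fun[OF Q(2,3), of G] by (simp add: Q(1) G_def)
      also have "\<dots> \<le> ennreal A * ennreal v"
        unfolding v(2) by (intro mult_right_mono A) simp
      finally have G: "(\<integral>\<^sup>+y\<in>Q. ennreal (G y) \<partial>lebesgue) \<le> ennreal (A * v)"
        using A v by (simp add: ennreal_mult)
      have one: "(\<integral>\<^sup>+y\<in>Q. ennreal 1 \<partial>lebesgue) \<le> ennreal v"
        using v Q by (simp add: nn_integral_indicator del: emeasure_completion)
      have "(\<integral>\<^sup>+y\<in>Q. ennreal \<bar>f y\<bar> \<partial>lebesgue) =
          (\<integral>\<^sup>+y. ennreal t * (ennreal (G y powr (1 / c) * 1 powr (1 - 1 / c)) * indicator Q y) \<partial>lebesgue)"
        using t c by (intro nn_integral_cong) (auto simp: G_def powr_powr indicator_def ennreal_mult[symmetric])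
      also have "\<dots> = ennreal t * (\<integral>\<^sup>+y\<in>Q. ennreal (G y powr (1 / c) * 1 powr (1 - 1 / c)) \<partial>lebesgue)"
        unfolding Q by (intro nn_integral_cmult) measurable
      also have "\<dots> \<le> ennreal t * ennreal ((A * v) powr (1 / c) * v powr (1 - 1 / c))"
        using c v A G one Q by (intro mult_left_mono nn_integral_Holder) (auto simp: G_def)
      also have "\<dots> = ennreal (t * A powr (1 / c)) * ennreal v"
        using t v A by (simp add: ennreal_mult[symmetric] powr_mult mult.assoc flip: powr_add)
      finally show "(\<integral>\<^sup>+y\<in>Q. ennreal \<bar>f y\<bar> \<partial>lebesgue) / emeasure lebesgue Q \<le> ennreal (1 * t * A powr (1 / c))"
        unfolding v(2) using v(1) by (intro divide_le_ennreal_iff[THEN iffD2]) simp_all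
    qed
    moreover have "(\<lambda>x. enn2real (maximal_fun f x)) \<in> borel_measurable lebesgue"
      using borel_measurable_maximal_fun[of f] by (intro measurable_completion) simp
    ultimately show "(\<lambda>x. enn2real (maximal_fun f x)) \<in> borel_measurable lebesgue \<and>
      (\<exists>G\<in>borel_measurable lebesgue. modular s G \<le> 1 \<and>
         (AE x in lebesgue. \<forall>A>0. maximal_fun G x \<le> ennreal A \<longrightarrow> maximal_fun f x \<le> ennreal (1 * t * A powr (1 / c))))"
      by (intro conjI bexI[of _ G] AE_I2 allI impI) auto
  qed (use c in auto)
  then show ?thesis
    using csP by (simp add: exponents_B_def)
qed

text \<open>Every \<open>u \<ge> 0\<close> satisfies \<open>u \<le> 1 + u powr p y\<close>; for
  \<open>u = \<bar>f y / t\<bar>\<close> this bounds the local integral by the volume of the cube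
  plus the modular. It supplies the finiteness needed for measurability of the commutator.\<close>

lemma modular_imp_locally_finite:
  fixes f :: "real ^ 'n \<Rightarrow> real"
  assumes p: "p \<in> variable_exponents" and f [measurable]: "f \<in> borel_measurable lebesgue"
    and t: "0 < t" and m: "modular p (\<lambda>x. f x / t) \<le> 1" and l: "0 \<le> l"
  shows "(\<integral>\<^sup>+y\<in>cube a l. ennreal \<bar>f y\<bar> \<partial>lebesgue) < \<infinity>"
proof -
  note [measurable] = variable_exponents_measurable[OF p]
  have "(\<integral>\<^sup>+y\<in>cube a l. ennreal \<bar>f y\<bar> \<partial>lebesgue) \<le>
      (\<integral>\<^sup>+y. ennreal t * indicator (cube a l) y + ennreal t * ennreal (\<bar>f y / t\<bar> powr p y) \<partial>lebesgue)"
  proof (intro nn_integral_mono)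
    fix y
    have "\<bar>f y / t\<bar> \<le> 1 + \<bar>f y / t\<bar> powr p y"
    proof (cases "\<bar>f y / t\<bar> \<le> 1")
      case False
      then have "\<bar>f y / t\<bar> powr 1 \<le> \<bar>f y / t\<bar> powr p y"
        using variable_exponents_ge_1[OF p, of y] by (intro powr_mono) auto
      then show ?thesis using False by simp
    qed (auto intro: add_increasing2)
    then have "t * \<bar>f y / t\<bar> \<le> t * (1 + \<bar>f y / t\<bar> powr p y)"
      using t by (intro mult_left_mono) auto
    then have "\<bar>f y\<bar> \<le> t + t * \<bar>f y / t\<bar> powr p y"
      using t by (simp add: distrib_left)
    then show "ennreal \<bar>f y\<bar> * indicator (cube a l) y \<le>
      ennreal t * indicator (cube a l) y + ennreal t * ennreal (\<bar>f y / t\<bar> powr p y)"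
      using t by (auto simp: indicator_def ennreal_mult[symmetric] ennreal_plus[symmetric] simp del: ennreal_plus intro!: ennreal_leI)
  qed
  also have "\<dots> = ennreal t * emeasure lebesgue (cube a l) + ennreal t * modular p (\<lambda>x. f x / t)"
    unfolding modular_def
    by (subst nn_integral_add) (auto simp: nn_integral_cmult_indicator nn_integral_cmult simp del: emeasure_completion)
  also have "\<dots> < \<infinity>"
    using m l le_less_trans[OF m ennreal_one_less_top]
    by (auto simp: emeasure_cube ennreal_mult_less_top simp del: emeasure_completion)
  finally show ?thesis .
qed

section \<open>Admissible constant exponents\<close>

lemma const_exponents_P:
  assumes "1 < c"
  shows "(\<lambda>x::real ^ 'n. c) \<in> exponents_P" "exp_plus (\<lambda>x::real ^ 'n. c) = ereal c"
proof -
  have ne: "emeasure lebesgue (space (lebesgue :: (real ^ 'n) measure)) \<noteq> 0"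
    by simp
  show plus: "exp_plus (\<lambda>x::real ^ 'n. c) = ereal c"
    unfolding exp_plus_def by (rule esssup_const[OF ne])
  have "ereal c \<le> exp_minus (\<lambda>x::real ^ 'n. c)"
    unfolding exp_minus_def by (intro Sup_upper) simp
  then have "1 < exp_minus (\<lambda>x::real ^ 'n. c)"
    using assms less_le_trans[of 1 "ereal c"] by simp
  then show "(\<lambda>x::real ^ 'n. c) \<in> exponents_P"
    using assms plus by (auto simp: exponents_P_def variable_exponents_def)
qed

lemma const_2_exponents_B: "(\<lambda>x::real ^ 'n. 2) \<in> exponents_B"
proof -
  have P: "(\<lambda>x::real ^ 'n. 2) \<in> exponents_P"
    by (rule const_exponents_P) simp
  then have ve: "(\<lambda>x::real ^ 'n. 2) \<in> variable_exponents"
    by (simp add: exponents_P_def)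
  \<comment> \<open>The added 1 ensures \<open>1 \<le> C\<close>. The integral of the square is
    bounded with constant \<open>C\<close>, and dividing by the square of \<open>C\<close> leaves
    \<open>1 / C\<close>, so no square root has to be taken.\<close>
  define C where "C = 8 * (10 * real CARD('n)) ^ CARD('n) + 1"
  have C: "1 \<le> C" by (simp add: C_def)
  have "bounded_operator maximal_fun (\<lambda>x::real ^ 'n. 2) (\<lambda>x. 2)"
    unfolding bounded_operator_iff_modular[OF ve ve]
  proof (intro exI[of _ C] conjI ballI allI impI)
    show "0 < C" using C by simp
    fix f :: "real ^ 'n \<Rightarrow> real" and t :: real
    assume f [measurable]: "f \<in> borel_measurable lebesgue" and t: "0 < t" and m: "modular (\<lambda>x. 2) (\<lambda>x. f x / t) \<le> 1"
    have M [measurable]: "maximal_fun f \<in> borel_measurable lebesgue"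
      using borel_measurable_maximal_fun[of f] by (intro measurable_completion) simp
    show "(\<lambda>x. enn2real (maximal_fun f x)) \<in> borel_measurable lebesgue"
      by measurable
    have "(\<integral>\<^sup>+x. ennreal (\<bar>f x\<bar> * \<bar>f x\<bar>) \<partial>lebesgue) = (\<integral>\<^sup>+x. ennreal (t * t) * ennreal (\<bar>f x / t\<bar> powr 2) \<partial>lebesgue)"
      using t by (intro nn_integral_cong) (auto simp: ennreal_mult[symmetric] power2_eq_square)
    also have "\<dots> = ennreal (t * t) * modular (\<lambda>x. 2) (\<lambda>x. f x / t)"
      unfolding modular_def by (intro nn_integral_cmult) measurable
    also have "\<dots> \<le> ennreal (t * t) * 1"
      by (intro mult_left_mono m) simp
    finally have f2: "(\<integral>\<^sup>+x. ennreal (\<bar>f x\<bar> * \<bar>f x\<bar>) \<partial>lebesgue) \<le> ennreal (t * t)"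
      by simp
    have "(\<integral>\<^sup>+x. maximal_fun f x * maximal_fun f x \<partial>lebesgue) \<le>
      ennreal (8 * (10 * real CARD('n)) ^ CARD('n)) * (\<integral>\<^sup>+x. ennreal (\<bar>f x\<bar> * \<bar>f x\<bar>) \<partial>lebesgue)"
      by (rule maximal_fun_L2[OF f])
    also have "\<dots> \<le> ennreal C * ennreal (t * t)"
      using f2 by (intro mult_mono ennreal_leI) (auto simp: C_def)
    also have "\<dots> = ennreal (C * (t * t))"
      using C t by (simp add: ennreal_mult)
    finally have M2: "(\<integral>\<^sup>+x. maximal_fun f x * maximal_fun f x \<partial>lebesgue) \<le> ennreal (C * (t * t))" .
    have "AE x in lebesgue. maximal_fun f x * maximal_fun f x \<noteq> \<infinity>"
      using M2 by (intro nn_integral_PInf_AE) (auto simp: top_unique)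
    then show fin: "AE x in lebesgue. maximal_fun f x < \<infinity>"
      by eventually_elim (auto simp: ennreal_mult_eq_top_iff less_top[symmetric])
    have "modular (\<lambda>x. 2) (\<lambda>x. enn2real (maximal_fun f x) / (C * t)) \<le>
        (\<integral>\<^sup>+x. ennreal (1 / (C * t)\<^sup>2) * (maximal_fun f x * maximal_fun f x) \<partial>lebesgue)"
      unfolding modular_def
    proof (rule nn_integral_mono_AE)
      show "AE x in lebesgue. ennreal (\<bar>enn2real (maximal_fun f x) / (C * t)\<bar> powr 2) \<le>
          ennreal (1 / (C * t)\<^sup>2) * (maximal_fun f x * maximal_fun f x)"
        using fin
      proof eventually_elim
        case (elim x)
        then obtain r where "0 \<le> r" "maximal_fun f x = ennreal r"
          by (cases "maximal_fun f x") auto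
        then show ?case
          using C t by (simp add: ennreal_mult[symmetric] power2_eq_square powr_numeral)
      qed
    qed
    also have "\<dots> = ennreal (1 / (C * t)\<^sup>2) * (\<integral>\<^sup>+x. maximal_fun f x * maximal_fun f x \<partial>lebesgue)"
      by (intro nn_integral_cmult) measurable
    also have "\<dots> \<le> ennreal (1 / (C * t)\<^sup>2) * ennreal (C * (t * t))"
      by (intro mult_left_mono M2) simp
    also have "\<dots> = ennreal (1 / C)"
      using C t by (simp add: ennreal_mult[symmetric] power2_eq_square)
    also have "\<dots> \<le> 1"
      using C by simp
    finally show "modular (\<lambda>x. 2) (\<lambda>x. enn2real (maximal_fun f x) / (C * t)) \<le> 1" .
  qed
  with P show ?thesis by (simp add: exponents_B_def)
qed

lemma exponent_pairs_nonempty: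
  assumes "0 < \<beta>" "\<beta> < 1"
  shows "(exponent_pairs \<beta> :: ((real ^ 'n \<Rightarrow> real) \<times> _) set) \<noteq> {}"
proof -
  define n where "n = real CARD('n)"
  have "1 \<le> CARD('n)"
    by (simp add: Suc_le_eq)
  then have n: "1 \<le> n"
    by (simp add: n_def)
  \<comment> \<open>This value solves \<open>1 / p = 1 / q + \<beta> / n\<close> for
    \<open>q = 2 * n / (n - \<beta>)\<close>; it exceeds 1 because
    \<open>\<beta> < n\<close>.\<close>
  have p1: "1 < 2 * n / (n + \<beta>)"
    using n assms by (simp add: field_simps)
  have "ereal \<beta> < ereal n / exp_plus (\<lambda>x::real ^ 'n. 2 * n / (n + \<beta>))"
    unfolding const_exponents_P(2)[OF p1] using n assms by (simp add: field_simps)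
  moreover have "1 / (2 * n / (n - \<beta>)) = 1 / (2 * n / (n + \<beta>)) - \<beta> / n"
    using n assms by (simp add: field_simps)
  moreover have "(2 * n / (n - \<beta>)) * (n - \<beta>) / n = 2"
    using n assms by simp
  moreover have "1 \<le> 2 * n / (n - \<beta>)"
    using n assms by (simp add: field_simps)
  ultimately have "((\<lambda>x::real ^ 'n. 2 * n / (n + \<beta>)), (\<lambda>x. 2 * n / (n - \<beta>))) \<in> exponent_pairs \<beta>"
    unfolding exponent_pairs_def n_def[symmetric]
    using const_exponents_P(1)[OF p1] const_2_exponents_B assms
    by (simp add: variable_exponents_def)
  then show ?thesis by blast
qed

section \<open>Commutators with Lipschitz functions\<close>

lemma hom_lipschitzE:
  assumes "b \<in> hom_lipschitz \<beta>"
  obtains g L where "AE x in lebesgue. b x = g x" "0 < L" "\<And>x y. \<bar>g x - g y\<bar> \<le> L * norm (x - y) powr \<beta>"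
proof -
  obtain g C where g: "AE x in lebesgue. b x = g x" "\<And>x y. \<bar>g x - g y\<bar> \<le> C * norm (x - y) powr \<beta>"
    using assms by (auto simp: hom_lipschitz_def)
  have "\<bar>g x - g y\<bar> \<le> (\<bar>C\<bar> + 1) * norm (x - y) powr \<beta>" for x y
    by (rule order_trans[OF g(2)]) (intro mult_right_mono, auto)
  then show ?thesis
    using that[of g "\<bar>C\<bar> + 1"] g(1) by auto
qed

lemma lipschitz_cube:
  fixes g :: "real ^ 'n \<Rightarrow> real"
  assumes g: "\<And>x y. \<bar>g x - g y\<bar> \<le> L * norm (x - y) powr \<beta>" and "0 < L" "0 < \<beta>" "0 < l"
    and "x \<in> cube a l" "y \<in> cube a l"
  shows "\<bar>g x - g y\<bar> \<le> L * real CARD('n) powr \<beta> * l powr \<beta>"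
proof -
  have "norm (x - y) powr \<beta> \<le> (real CARD('n) * l) powr \<beta>"
    using dist_cube_le[OF assms(5,6)] assms by (intro powr_mono2) auto
  then have "L * norm (x - y) powr \<beta> \<le> L * (real CARD('n) powr \<beta> * l powr \<beta>)"
    using assms by (intro mult_left_mono) (auto simp: powr_mult)
  with g[of x y] show ?thesis by (simp add: mult.assoc)
qed

lemma lipschitz_continuous:
  fixes g :: "real ^ 'n \<Rightarrow> real"
  assumes g: "\<And>x y. \<bar>g x - g y\<bar> \<le> L * norm (x - y) powr \<beta>" and "0 < \<beta>"
  shows "continuous_on UNIV g"
  unfolding continuous_on_def
proof
  fix x :: "real ^ 'n"
  have "((\<lambda>y. L * norm (y - x) powr \<beta>) \<longlongrightarrow> L * norm (x - x) powr \<beta>) (at x)"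
    using assms(2) by (intro tendsto_intros tendsto_powr') auto
  then have "((\<lambda>y. L * norm (y - x) powr \<beta>) \<longlongrightarrow> 0) (at x)"
    using assms(2) by simp
  then have "((\<lambda>y. g y - g x) \<longlongrightarrow> 0) (at x)"
    by (rule Lim_null_comparison[rotated]) (use g in auto)
  then show "(g \<longlongrightarrow> g x) (at x within UNIV)"
    by (simp add: Lim_null[of g])
qed

text \<open>The value of \<open>b\<close> at \<open>x\<close> enters the supremum pointwise, so
  equality at \<open>x\<close> is assumed in addition to equality almost everywhere.\<close>

lemma maximal_commutator_cong_AE:
  fixes b g :: "real ^ 'n \<Rightarrow> real"
  assumes "AE y in lebesgue. b y = g y" "b x = g x"
  shows "maximal_commutator b f x = maximal_commutator g f x"
proof -
  have "(\<integral>\<^sup>+y\<in>Q. ennreal (\<bar>b x - b y\<bar> * \<bar>f y\<bar>) \<partial>lebesgue) = (\<integral>\<^sup>+y\<in>Q. ennreal (\<bar>g x - g y\<bar> * \<bar>f y\<bar>) \<partial>lebesgue)" for Q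
    using assms by (intro nn_integral_cong_AE) auto
  then show ?thesis
    by (simp add: maximal_commutator_def)
qed

text \<open>On a cube of side \<open>l\<close> the Lipschitz bound contributes
  \<open>l powr \<beta>\<close>. Hoelder's inequality splits \<open>\<bar>f / t\<bar>\<close> into a
  power of \<open>G\<close>, controlled by the maximal function, and a power of \<open>w\<close>,
  controlled by the modular of \<open>f\<close>.\<close>

lemma maximal_commutator_bounded:
  fixes b :: "real ^ 'n \<Rightarrow> real"
  assumes b: "b \<in> hom_lipschitz \<beta>" and \<beta>: "0 < \<beta>" "\<beta> < 1" and pq: "(p, q) \<in> exponent_pairs \<beta>"
  shows "bounded_operator (maximal_commutator b) p q"
proof -
  define n where "n = real CARD('n)"
  have "1 \<le> CARD('n)"
    by (simp add: Suc_le_eq)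
  then have n: "1 \<le> n"
    by (simp add: n_def)
  define s where "s = (\<lambda>x. q x * (n - \<beta>) / n)"
  define e where "e = (n - \<beta>) / n"
  have e: "0 < e" "e < 1" "1 - e = \<beta> / n"
    using n \<beta> by (auto simp: e_def field_simps)
  have p: "p \<in> variable_exponents" and q: "q \<in> variable_exponents" and sB: "s \<in> exponents_B"
    and rel: "AE x in lebesgue. 1 / q x = 1 / p x - \<beta> / n"
    using pq by (auto simp: exponent_pairs_def exponents_P_def s_def n_def)
  note [measurable] = variable_exponents_measurable[OF p] variable_exponents_measurable[OF q]
  obtain g L where g: "AE x in lebesgue. b x = g x" "0 < L" "\<And>x y. \<bar>g x - g y\<bar> \<le> L * norm (x - y) powr \<beta>"
    using hom_lipschitzE[OF b] by metis
  have gc: "continuous_on UNIV g"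
    by (rule lipschitz_continuous[OF g(3) \<beta>(1)])
  \<comment> \<open>The power of n comes from the diameter bound in
    \<open>lipschitz_cube\<close>.\<close>
  define k where "k = L * n powr \<beta>"
  have k: "0 < k" using g n by (simp add: k_def)
  show ?thesis
  proof (rule bounded_operator_by_maximal_fun[OF sB p q e(1) _ k])
    show "e * q x = s x" for x
      by (simp add: e_def s_def)
    fix f :: "real ^ 'n \<Rightarrow> real" and t :: real
    assume f [measurable]: "f \<in> borel_measurable lebesgue" and t: "0 < t" and m: "modular p (\<lambda>x. f x / t) \<le> 1"
    \<comment> \<open>Measurability is proved for the continuous representative \<open>g\<close> and
      carried over to \<open>b\<close>, whose commutator agrees with it almost everywhere.\<close>
    have "maximal_commutator g f \<in> borel_measurable borel"
    by (rule borel_measurable_maximal_commutator[OF gc f]) (rule modular_imp_locally_finite[OF p f t m less_imp_le])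
    then have "maximal_commutator g f \<in> borel_measurable lebesgue"
      by (intro measurable_completion) simp
    then have "(\<lambda>x. enn2real (maximal_commutator g f x)) \<in> borel_measurable lebesgue"
      by measurable
    moreover have "AE x in lebesgue. enn2real (maximal_commutator g f x) = enn2real (maximal_commutator b f x)"
      using g(1) by eventually_elim (simp add: maximal_commutator_cong_AE[OF g(1)])
    ultimately have meas: "(\<lambda>x. enn2real (maximal_commutator b f x)) \<in> borel_measurable lebesgue"
      by (rule borel_measurable_AE)
    \<comment> \<open>The exponent \<open>p x / s x\<close> makes the \<open>s\<close>-modular of
      \<open>G\<close> equal to the \<open>p\<close>-modular of \<open>f / t\<close>.\<close>
    define G where "G = (\<lambda>x. \<bar>f x / t\<bar> powr (p x / s x))"
    have sm [measurable]: "s \<in> borel_measurable lebesgue"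
      unfolding s_def by measurable
    have s1: "1 \<le> s x" for x
      using sB by (auto simp: exponents_B_def exponents_P_def variable_exponents_def)
    have Gm [measurable]: "G \<in> borel_measurable lebesgue"
      unfolding G_def by measurable
    have "modular s G = modular p (\<lambda>x. f x / t)"
      unfolding modular_def G_def
    proof (intro nn_integral_cong)
      fix x
      have "s x \<noteq> 0"
        using s1[of x] by auto
      then show "ennreal (\<bar>\<bar>f x / t\<bar> powr (p x / s x)\<bar> powr s x) = ennreal (\<bar>f x / t\<bar> powr p x)"
        by (simp add: powr_powr)
    qed
    then have G1: "modular s G \<le> 1" using m by simp
    define w where "w = (\<lambda>x. \<bar>f x / t\<bar> powr p x)"
    have wm [measurable]: "w \<in> borel_measurable lebesgue"
      unfolding w_def by measurable
    have fGw: "AE y in lebesgue. \<bar>f y / t\<bar> = G y powr e * w y powr (1 - e)"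
      using rel
    proof eventually_elim
      case (elim y)
      have pq1: "1 \<le> p y" "1 \<le> q y"
        using p q by (auto intro: variable_exponents_ge_1)
      \<comment> \<open>Because \<open>s y = e * q y\<close>, the first term is
        \<open>p y / q y\<close>; the relation between the exponents then makes the total exponent
        1.\<close>
      have "p y / s y * e + p y * (1 - e) = p y * (1 / q y) + p y * (\<beta> / n)"
        using n \<beta> pq1 unfolding e(3) by (simp add: s_def e_def)
      also have "\<dots> = 1"
        unfolding elim using pq1 by (simp add: algebra_simps)
      finally have "p y / s y * e + p y * (1 - e) = 1" .
      then show ?case
        by (simp only: G_def w_def powr_powr powr_add[symmetric]) simp
    qed
    have "AE x in lebesgue. \<forall>A>0. maximal_fun G x \<le> ennreal A \<longrightarrow> maximal_commutator b f x \<le> ennreal (k * t * A powr e)"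
      using g(1)
    proof (eventually_elim, intro allI impI)
      fix x A assume bx: "b x = g x" and A: "0 < A" "maximal_fun G x \<le> ennreal A"
      show "maximal_commutator b f x \<le> ennreal (k * t * A powr e)"
        unfolding maximal_commutator_def
      proof (rule SUP_least)
        fix Q assume "Q \<in> {Q \<in> cubes. x \<in> Q}"
        then obtain a l where Q: "Q = cube a l" "0 < l" "x \<in> cube a l"
          by (auto simp: cubes_iff)
        define v where "v = l ^ CARD('n)"
        have v: "0 < v" "emeasure lebesgue Q = ennreal v"
          using Q emeasure_cube[of l a] by (simp_all add: v_def del: emeasure_completion)
        have vp: "v = l powr n"
          using Q by (simp add: v_def n_def powr_realpow)
        have "(\<integral>\<^sup>+y\<in>Q. ennreal (G y) \<partial>lebesgue) \<le> maximal_fun G x * emeasure lebesgue Q"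
          using avg_le_maximal_fun[OF Q(2,3), of G] by (simp add: Q(1) G_def)
        also have "\<dots> \<le> ennreal A * ennreal v"
          unfolding v(2) by (intro mult_right_mono A) simp
        finally have GA: "(\<integral>\<^sup>+y\<in>Q. ennreal (G y) \<partial>lebesgue) \<le> ennreal (A * v)"
          using A v by (simp add: ennreal_mult)
        have "(\<integral>\<^sup>+y\<in>Q. ennreal (w y) \<partial>lebesgue) \<le> modular p (\<lambda>x. f x / t)"
          unfolding modular_def w_def by (intro nn_integral_mono) (auto simp: indicator_def)
        with m have w1: "(\<integral>\<^sup>+y\<in>Q. ennreal (w y) \<partial>lebesgue) \<le> ennreal 1"
          by simp
        have "(\<integral>\<^sup>+y\<in>Q. ennreal (\<bar>b x - b y\<bar> * \<bar>f y\<bar>) \<partial>lebesgue) \<le>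
            (\<integral>\<^sup>+y. ennreal (k * l powr \<beta> * t) * (ennreal (G y powr e * w y powr (1 - e)) * indicator Q y) \<partial>lebesgue)"
        proof (rule nn_integral_mono_AE)
          show "AE y in lebesgue. ennreal (\<bar>b x - b y\<bar> * \<bar>f y\<bar>) * indicator Q y \<le>
            ennreal (k * l powr \<beta> * t) * (ennreal (G y powr e * w y powr (1 - e)) * indicator Q y)"
            using g(1) fGw
          proof eventually_elim
            case (elim y)
            show ?case
            proof (cases "y \<in> Q")
              case True
              then have "\<bar>g x - g y\<bar> \<le> k * l powr \<beta>"
                using lipschitz_cube[OF g(3,2) \<beta>(1) Q(2,3), of y] by (simp add: Q k_def n_def)
              then have "\<bar>b x - b y\<bar> * \<bar>f y\<bar> \<le> (k * l powr \<beta>) * \<bar>f y\<bar>"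
                unfolding bx elim(1) by (rule mult_right_mono) simp
              also have "(k * l powr \<beta>) * \<bar>f y\<bar> = (k * l powr \<beta> * t) * \<bar>f y / t\<bar>"
                using t by simp
              also have "\<dots> = (k * l powr \<beta> * t) * (G y powr e * w y powr (1 - e))"
                by (simp only: elim(2))
              finally show ?thesis
                using True k t by (simp add: ennreal_mult[symmetric] ennreal_leI)
            qed simp
          qed
        qed
        also have "\<dots> = ennreal (k * l powr \<beta> * t) * (\<integral>\<^sup>+y\<in>Q. ennreal (G y powr e * w y powr (1 - e)) \<partial>lebesgue)"
          unfolding Q by (intro nn_integral_cmult) measurable
        also have "\<dots> \<le> ennreal (k * l powr \<beta> * t) * ennreal ((A * v) powr e * 1 powr (1 - e))"
          using e v A GA w1 Q by (intro mult_left_mono nn_integral_Holder) (auto simp: G_def w_def)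
        also have "\<dots> = ennreal (k * t * A powr e * (l powr \<beta> * v powr e))"
          using t v A k by (simp add: ennreal_mult[symmetric] powr_mult mult_ac)
        \<comment> \<open>With \<open>v = l powr n\<close> and \<open>n * e = n - \<beta>\<close>,
          the Lipschitz factor restores exactly the power of the volume lost in Hoelder's
          inequality.\<close>
        also have "l powr \<beta> * v powr e = v"
          using n Q by (simp add: vp powr_powr e_def flip: powr_add)
        also have "ennreal (k * t * A powr e * v) = ennreal (k * t * A powr e) * ennreal v"
          using k t v by (intro ennreal_mult) auto
        finally show "(\<integral>\<^sup>+y\<in>Q. ennreal (\<bar>b x - b y\<bar> * \<bar>f y\<bar>) \<partial>lebesgue) / emeasure lebesgue Q \<le> ennreal (k * t * A powr e)"
          unfolding v(2) using v(1) by (intro divide_le_ennreal_iff[THEN iffD2]) simp_all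
      qed
    qed
    with meas G1 Gm
    show "(\<lambda>x. enn2real (maximal_commutator b f x)) \<in> borel_measurable lebesgue \<and>
      (\<exists>G\<in>borel_measurable lebesgue. modular s G \<le> 1 \<and>
         (AE x in lebesgue. \<forall>A>0. maximal_fun G x \<le> ennreal A \<longrightarrow> maximal_commutator b f x \<le> ennreal (k * t * A powr e)))"
      by blast
  qed
qed

section \<open>Oscillation in variable exponent spaces\<close>

lemma locally_integrable_measurable:
  fixes b :: "real ^ 'n \<Rightarrow> real"
  assumes "locally_integrable b"
  shows "b \<in> borel_measurable lebesgue"
\<comment> \<open>The function is the pointwise limit of its integrable truncations to balls of
  integer radius.\<close>
proof (rule borel_measurable_LIMSEQ_real)
  show "(\<lambda>x. indicator (cball 0 (real i)) x *\<^sub>R b x) \<in> borel_measurable lebesgue" for i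
    using assms unfolding locally_integrable_def set_integrable_def by (intro borel_measurable_integrable) auto
  fix x :: "real ^ 'n"
  obtain k where k: "norm x \<le> real k"
    using real_arch_simple by blast
  have "eventually (\<lambda>i. indicator (cball 0 (real i)) x *\<^sub>R b x = b x) sequentially"
    using eventually_ge_at_top[of k] by eventually_elim (use k in auto)
  then show "(\<lambda>i. indicator (cball 0 (real i)) x *\<^sub>R b x) \<longlonglongrightarrow> b x"
    by (rule tendsto_eventually)
qed

text \<open>The difference \<open>c - cube_avg b Q\<close> is the average of \<open>c - b\<close>
  over \<open>Q\<close>, so the triangle inequality for integrals applies. It is used with
  \<open>c\<close> a value of \<open>b\<close> and with \<open>c\<close> an average over another
  cube.\<close>

lemma cube_avg_dist_le:
  fixes b :: "real ^ 'n \<Rightarrow> real"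
  assumes b: "locally_integrable b" and l: "0 < l"
  shows "ennreal (\<bar>c - cube_avg b (cube a l)\<bar> * l ^ CARD('n)) \<le> (\<integral>\<^sup>+y\<in>cube a l. ennreal \<bar>c - b y\<bar> \<partial>lebesgue)"
proof -
  let ?Q = "cube a l"
  define v where "v = l ^ CARD('n)"
  have v: "0 < v" "measure lebesgue ?Q = v"
    using l measure_cube[of l a] by (auto simp: v_def)
  have i1: "set_integrable lebesgue ?Q b"
    using b by (simp add: locally_integrable_def)
  have fin: "emeasure lebesgue ?Q < \<infinity>"
    using l by (subst emeasure_cube) auto
  have i2: "set_integrable lebesgue ?Q (\<lambda>y. c)"
    unfolding set_integrable_def using fin by (intro integrable_scaleR_left integrable_real_indicator) auto
  have "(LINT y:?Q|lebesgue. c - b y) = c * v - cube_avg b ?Q * v"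
    using v fin by (subst set_integral_diff[OF i2 i1])
      (simp add: cube_avg_def set_lebesgue_integral_def)
  then have "\<bar>c - cube_avg b ?Q\<bar> * v = norm (LINT y:?Q|lebesgue. c - b y)"
    using v by (simp add: abs_mult flip: left_diff_distrib)
  also have "ennreal \<dots> \<le> (\<integral>\<^sup>+y. ennreal (norm (indicator ?Q y *\<^sub>R (c - b y))) \<partial>lebesgue)"
    unfolding set_lebesgue_integral_def
    using set_integral_diff(1)[OF i2 i1] by (intro integral_norm_bound_ennreal) (simp add: set_integrable_def)
  also have "\<dots> = (\<integral>\<^sup>+y\<in>?Q. ennreal \<bar>c - b y\<bar> \<partial>lebesgue)"
    by (intro nn_integral_cong) (auto simp: indicator_def)
  finally show ?thesis by (simp add: v_def)
qed

section \<open>Norms of indicators of cubes\<close>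

lemma modular_indicator_cube_le:
  fixes q :: "real ^ 'n \<Rightarrow> real"
  assumes q: "q \<in> variable_exponents" and l: "0 < l" and t: "1 \<le> t" "l ^ CARD('n) \<le> t"
  shows "modular q (\<lambda>x. indicator (cube a l) x / t) \<le> 1"
proof -
  have "modular q (\<lambda>x. indicator (cube a l) x / t) \<le> (\<integral>\<^sup>+x. ennreal (1 / t) * indicator (cube a l) x \<partial>lebesgue)"
    unfolding modular_def
  proof (intro nn_integral_mono)
    fix x
    have "(1 / t) powr q x \<le> (1 / t) powr 1"
      using t variable_exponents_ge_1[OF q, of x] by (intro powr_mono') auto
    then show "ennreal (\<bar>indicator (cube a l) x / t\<bar> powr q x) \<le> ennreal (1 / t) * indicator (cube a l) x"
      using t by (auto simp: indicator_def ennreal_leI)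
  qed
  also have "\<dots> = ennreal (1 / t) * ennreal (l ^ CARD('n))"
    using l emeasure_cube[of l a] by (simp add: nn_integral_cmult_indicator del: emeasure_completion)
  also have "\<dots> \<le> 1"
    using l t by (simp add: ennreal_mult[symmetric])
  finally show ?thesis .
qed

lemma indicator_cube_var_Lp:
  fixes q :: "real ^ 'n \<Rightarrow> real"
  assumes q: "q \<in> variable_exponents" and l: "0 < l"
  shows "indicator (cube a l) \<in> var_Lp q"
proof -
  have "modular q (\<lambda>x. indicator (cube a l) x / max 1 (l ^ CARD('n))) \<le> 1"
    by (rule modular_indicator_cube_le[OF q l]) auto
  then show ?thesis
    unfolding var_Lp_def
    by (auto intro!: exI[of _ "max 1 (l ^ CARD('n))"] le_less_trans[OF _ ennreal_one_less_top])
qed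

lemma var_Lp_norm_indicator_cube_pos:
  fixes q :: "real ^ 'n \<Rightarrow> real"
  assumes q: "q \<in> variable_exponents" and l: "0 < l"
  shows "0 < var_Lp_norm q (indicator (cube a l))"
proof (rule ccontr)
  assume zero: "\<not> 0 < var_Lp_norm q (indicator (cube a l))"
  define v where "v = l ^ CARD('n)"
  \<comment> \<open>The bound \<open>t < 1\<close> gives
    \<open>(1 / t) powr q x \<ge> 1 / t\<close>, and \<open>2 * t \<le> v\<close> then makes the
    modular at least 2, against the bound 1.\<close>
  define t where "t = min 1 v / 2"
  have v: "0 < v" using l by (simp add: v_def)
  then have t: "0 < t" "t < 1" "2 * t \<le> v" by (auto simp: t_def)
  have "var_Lp_norm q (indicator (cube a l)) < ennreal t"
    using zero t by simp
  then have m: "modular q (\<lambda>x. indicator (cube a l) x / t) \<le> 1"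
    by (rule var_Lp_norm_less_modular[OF q])
  have "ennreal 2 \<le> ennreal (1 / t) * ennreal v"
    using t v by (simp add: ennreal_mult[symmetric] field_simps del: ennreal_numeral)
  also have "\<dots> = (\<integral>\<^sup>+x. ennreal (1 / t) * indicator (cube a l) x \<partial>lebesgue)"
    using l emeasure_cube[of l a] by (simp add: nn_integral_cmult_indicator v_def del: emeasure_completion)
  also have "\<dots> \<le> modular q (\<lambda>x. indicator (cube a l) x / t)"
    unfolding modular_def
  proof (intro nn_integral_mono)
    fix x
    have "(1 / t) powr 1 \<le> (1 / t) powr q x"
      using t variable_exponents_ge_1[OF q, of x] by (intro powr_mono) auto
    then show "ennreal (1 / t) * indicator (cube a l) x \<le> ennreal (\<bar>indicator (cube a l) x / t\<bar> powr q x)"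
      using t by (auto simp: indicator_def ennreal_leI)
  qed
  also note m
  finally show False by simp
qed

lemma osc_sup_leI:
  fixes b q :: "real ^ 'n \<Rightarrow> real"
  assumes K: "0 \<le> K"
    and le: "\<And>a l. 0 < l \<Longrightarrow> var_Lp_norm q (\<lambda>x. (b x - cube_avg b (cube a l)) * indicator (cube a l) x) \<le>
      ennreal (K * l powr \<beta>) * var_Lp_norm q (indicator (cube a l))"
  shows "osc_sup \<beta> q b \<le> ennreal K"
  unfolding osc_sup_def
proof (rule SUP_least)
  fix Q :: "(real ^ 'n) set" assume "Q \<in> cubes"
  then obtain a l where Q: "Q = cube a l" "0 < l"
    by (auto simp: cubes_iff)
  define N where "N = var_Lp_norm q (indicator Q)"
  have meas: "measure lebesgue Q powr (\<beta> / real CARD('n)) = l powr \<beta>"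
    using Q measure_cube[of l a] by (simp add: powr_powr flip: powr_realpow)
  \<comment> \<open>In the extended nonnegative reals \<open>0 / 0\<close> and
    \<open>top / top\<close> are both 0, so the degenerate norms satisfy the inequality as
    well.\<close>
  have "N / N \<le> 1"
  proof (cases "N = 0 \<or> N = top")
    case False
    then show ?thesis by (simp add: less_top[symmetric])
  qed auto
  have "var_Lp_norm q (\<lambda>x. (b x - cube_avg b Q) * indicator Q x) / N \<le> ennreal (K * l powr \<beta>) * N / N"
    unfolding N_def Q(1) using le[OF Q(2), of a] by (intro divide_right_mono_ennreal)
  also have "\<dots> = ennreal (K * l powr \<beta>) * (N / N)"
    by (simp add: ennreal_times_divide)
  also have "\<dots> \<le> ennreal (K * l powr \<beta>) * 1"
    by (intro mult_left_mono \<open>N / N \<le> 1\<close>) simp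
  finally have "ennreal (1 / l powr \<beta>) * (var_Lp_norm q (\<lambda>x. (b x - cube_avg b Q) * indicator Q x) / N) \<le>
      ennreal (1 / l powr \<beta>) * ennreal (K * l powr \<beta>)"
    by (intro mult_left_mono) auto
  also have "\<dots> = ennreal K"
    using K Q by (simp add: ennreal_mult[symmetric])
  finally show "ennreal (1 / measure lebesgue Q powr (\<beta> / real CARD('n))) *
         (var_Lp_norm q (\<lambda>x. (b x - cube_avg b Q) * indicator Q x) / var_Lp_norm q (indicator Q)) \<le> ennreal K"
    unfolding meas N_def .
qed

text \<open>Almost everywhere on a cube of side \<open>l\<close>, \<open>b\<close> differs from its
  average by at most \<open>K * l powr \<beta>\<close>. Such a pointwise bound passes to the norm of
  any variable exponent.\<close>

lemma osc_sup_finite_if_lipschitz: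
  fixes b q :: "real ^ 'n \<Rightarrow> real"
  assumes b: "locally_integrable b" and lip: "b \<in> hom_lipschitz \<beta>" and \<beta>: "0 < \<beta>" and q: "q \<in> variable_exponents"
  shows "osc_sup \<beta> q b < \<infinity>"
proof -
  note [measurable] = locally_integrable_measurable[OF b]
  obtain g L where g: "AE x in lebesgue. b x = g x" "0 < L" "\<And>x y. \<bar>g x - g y\<bar> \<le> L * norm (x - y) powr \<beta>"
    using hom_lipschitzE[OF lip] by metis
  define K where "K = L * real CARD('n) powr \<beta>"
  have K: "0 < K" using g(2) by (simp add: K_def)
  have "osc_sup \<beta> q b \<le> ennreal K"
  proof (rule osc_sup_leI)
    fix a :: "real ^ 'n" and l :: real assume l: "0 < l"
    let ?Q = "cube a l"
    have lp: "0 < l ^ CARD('n)" using l by simp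
    show "var_Lp_norm q (\<lambda>x. (b x - cube_avg b ?Q) * indicator ?Q x) \<le>
      ennreal (K * l powr \<beta>) * var_Lp_norm q (indicator ?Q)"
    proof (rule var_Lp_norm_mono_AE[OF q])
      show "AE x in lebesgue. \<bar>(b x - cube_avg b ?Q) * indicator ?Q x\<bar> \<le> K * l powr \<beta> * \<bar>indicator ?Q x\<bar>"
        using g(1)
      proof eventually_elim
        case (elim x)
        show ?case
        proof (cases "x \<in> ?Q")
          case True
          have "ennreal (\<bar>b x - cube_avg b ?Q\<bar> * l ^ CARD('n)) \<le> (\<integral>\<^sup>+y\<in>?Q. ennreal \<bar>b x - b y\<bar> \<partial>lebesgue)"
            by (rule cube_avg_dist_le[OF b l])
          also have "\<dots> \<le> (\<integral>\<^sup>+y. ennreal (K * l powr \<beta>) * indicator ?Q y \<partial>lebesgue)"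
          proof (rule nn_integral_mono_AE)
            show "AE y in lebesgue. ennreal \<bar>b x - b y\<bar> * indicator ?Q y \<le> ennreal (K * l powr \<beta>) * indicator ?Q y"
              using g(1)
            proof eventually_elim
              case (elim y)
              then show ?case
                using lipschitz_cube[OF g(3,2) \<beta> l True, of y] \<open>b x = g x\<close>
                by (auto simp: indicator_def K_def ennreal_leI)
            qed
          qed
          also have "\<dots> = ennreal (K * l powr \<beta>) * ennreal (l ^ CARD('n))"
            using l emeasure_cube[of l a] by (simp add: nn_integral_cmult_indicator del: emeasure_completion)
          also have "\<dots> = ennreal (K * l powr \<beta> * l ^ CARD('n))"
            using l K by (intro ennreal_mult[symmetric]) auto
          finally have "\<bar>b x - cube_avg b ?Q\<bar> * l ^ CARD('n) \<le> K * l powr \<beta> * l ^ CARD('n)"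
            using l K by (simp add: ennreal_le_iff)
          then show ?thesis
            using lp True by simp
        qed simp
      qed
    qed (use K l in auto)
  qed (use K in simp)
  also have "\<dots> < \<infinity>" by simp
  finally show ?thesis .
qed

text \<open>Young's inequality with the pointwise conjugate exponents \<open>q / p\<close> and \<open>n / (p \<beta>)\<close>.\<close>

lemma var_Lp_norm_indicator_cube_pair_le:
  fixes p q :: "real ^ 'n \<Rightarrow> real"
  assumes p: "p \<in> variable_exponents" and q: "q \<in> variable_exponents" and \<beta>: "0 < \<beta>"
    and rel: "AE x in lebesgue. 1 / q x = 1 / p x - \<beta> / real CARD('n)" and l: "0 < l"
  shows "var_Lp_norm p (indicator (cube a l)) \<le> ennreal (2 * l powr \<beta>) * var_Lp_norm q (indicator (cube a l))"
proof (rule var_Lp_norm_leI[OF q])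
  note [measurable] = variable_exponents_measurable[OF p] variable_exponents_measurable[OF q]
  let ?Q = "cube a l"
  define v where "v = l ^ CARD('n)"
  have v: "0 < v" "emeasure lebesgue ?Q = ennreal v"
    using l emeasure_cube[of l a] by (simp_all add: v_def del: emeasure_completion)
  fix t :: real assume t: "0 < t" and m: "modular q (\<lambda>x. indicator ?Q x / t) \<le> 1"
  have "modular p (\<lambda>x. indicator ?Q x / (l powr \<beta> * t)) \<le>
      (\<integral>\<^sup>+x. ennreal (\<bar>indicator ?Q x / t\<bar> powr q x) + ennreal (1 / v) * indicator ?Q x \<partial>lebesgue)"
    unfolding modular_def
  proof (rule nn_integral_mono_AE)
    show "AE x in lebesgue. ennreal (\<bar>indicator ?Q x / (l powr \<beta> * t)\<bar> powr p x) \<le>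
       ennreal (\<bar>indicator ?Q x / t\<bar> powr q x) + ennreal (1 / v) * indicator ?Q x"
      using rel
    proof eventually_elim
      case (elim x)
      show ?case
      proof (cases "x \<in> ?Q")
        case True
        define e where "e = p x / q x"
        have pq1: "1 \<le> p x" "1 \<le> q x"
          using p q by (auto intro: variable_exponents_ge_1)
        have e_alt: "e = 1 - p x * (\<beta> / real CARD('n))"
        proof -
          have "e = p x * (1 / q x)" by (simp add: e_def)
          also have "\<dots> = 1 - p x * (\<beta> / real CARD('n))"
            unfolding elim using pq1 by (simp add: algebra_simps)
          finally show ?thesis .
        qed
        have e: "0 < e" "e < 1"
        proof -
          show "0 < e" using pq1 by (simp add: e_def)
          have "0 < p x * (\<beta> / real CARD('n))" using pq1 \<beta> by simp
          then show "e < 1" by (simp add: e_alt)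
        qed
        have "(1 / (l powr \<beta> * t)) powr p x = (1 / t) powr p x * (1 / l powr \<beta>) powr p x"
          using l t by (simp add: powr_divide powr_mult)
        also have "(1 / t) powr p x = ((1 / t) powr q x) powr e"
          using pq1 t by (simp add: powr_powr e_def)
        also have "(1 / l powr \<beta>) powr p x = (1 / v) powr (1 - e)"
          using l by (simp add: v_def e_alt powr_divide powr_powr mult_ac flip: powr_realpow)
        also have "((1 / t) powr q x) powr e * (1 / v) powr (1 - e) \<le> e * (1 / t) powr q x + (1 - e) * (1 / v)"
          using e v by (intro weighted_AM_GM) auto
        also have "\<dots> \<le> (1 / t) powr q x + 1 / v"
          using e v by (intro add_mono mult_left_le_one_le) auto
        finally show ?thesis
          using True l t v by (simp add: ennreal_plus[symmetric] ennreal_leI del: ennreal_plus)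
      qed simp
    qed
  qed
  also have "\<dots> = modular q (\<lambda>x. indicator ?Q x / t) + ennreal (1 / v) * ennreal v"
    unfolding modular_def v(2)[symmetric]
    by (subst nn_integral_add) (auto simp: nn_integral_cmult_indicator simp del: emeasure_completion)
  also have "ennreal (1 / v) * ennreal v = 1"
    using v by (simp add: ennreal_mult[symmetric])
  also have "modular q (\<lambda>x. indicator ?Q x / t) + 1 \<le> 1 + 1"
    by (intro add_right_mono m)
  finally have two: "modular p (\<lambda>x. indicator ?Q x / (l powr \<beta> * t)) \<le> ennreal 2"
    by simp
  \<comment> \<open>A modular of at most 2 becomes at most 1 after doubling the scale; hence the
    factor 2 in the constant.\<close>
  have "modular p (\<lambda>x. indicator ?Q x / ((l powr \<beta> * t) * 2)) \<le> ennreal (1 / 2) * modular p (\<lambda>x. indicator ?Q x / (l powr \<beta> * t))"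
    using l t by (intro modular_divide_le[OF p]) auto
  also have "\<dots> \<le> ennreal (1 / 2) * ennreal 2"
    by (intro mult_left_mono two) simp
  also have "\<dots> = 1"
    by (subst ennreal_mult[symmetric]) auto
  finally show "modular p (\<lambda>x. indicator ?Q x / (2 * l powr \<beta> * t)) \<le> 1"
    by (simp add: mult_ac)
qed (use l in auto)

text \<open>The operator is tested on the indicator of a cube \<open>Q\<close>. For \<open>x\<close>
  in \<open>Q\<close> the cube \<open>Q\<close> itself competes in the supremum, which is therefore
  at least \<open>\<bar>b x - cube_avg b Q\<bar>\<close>. Replacing the \<open>p\<close>-norm of the
  indicator by its \<open>q\<close>-norm produces the factor
  \<open>2 * l powr \<beta>\<close>.\<close>

lemma osc_sup_finite_if_bounded:
  fixes b p q :: "real ^ 'n \<Rightarrow> real"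
  assumes b: "locally_integrable b" and \<beta>: "0 < \<beta>" and pq: "(p, q) \<in> exponent_pairs \<beta>"
    and bd: "bounded_operator (maximal_commutator b) p q"
  shows "osc_sup \<beta> q b < \<infinity>"
proof -
  note [measurable] = locally_integrable_measurable[OF b]
  have p: "p \<in> variable_exponents" and q: "q \<in> variable_exponents"
    and rel: "AE x in lebesgue. 1 / q x = 1 / p x - \<beta> / real CARD('n)"
    using pq by (auto simp: exponent_pairs_def exponents_P_def)
  obtain C0 where C0: "\<And>f. f \<in> var_Lp p \<Longrightarrow> (AE x in lebesgue. maximal_commutator b f x < \<infinity>)"
      "\<And>f. f \<in> var_Lp p \<Longrightarrow> var_Lp_norm q (\<lambda>x. enn2real (maximal_commutator b f x)) \<le> ennreal C0 * var_Lp_norm p f"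
    using bd unfolding bounded_operator_def by blast
  define C where "C = \<bar>C0\<bar>"
  have C: "0 \<le> C" "ennreal C0 \<le> ennreal C"
    by (auto simp: C_def intro: ennreal_leI)
  have "osc_sup \<beta> q b \<le> ennreal (2 * C)"
  proof (rule osc_sup_leI)
    fix a :: "real ^ 'n" and l :: real assume l: "0 < l"
    let ?Q = "cube a l"
    let ?f = "indicator ?Q :: real ^ 'n \<Rightarrow> real"
    have f: "?f \<in> var_Lp p"
      by (rule indicator_cube_var_Lp[OF p l])
    have Q: "emeasure lebesgue ?Q = ennreal (l ^ CARD('n))" "0 < l ^ CARD('n)"
      using l emeasure_cube[of l a] by (simp_all del: emeasure_completion)
    have "var_Lp_norm q (\<lambda>x. (b x - cube_avg b ?Q) * ?f x) \<le>
        ennreal 1 * var_Lp_norm q (\<lambda>x. enn2real (maximal_commutator b ?f x))"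
    proof (rule var_Lp_norm_mono_AE[OF q])
      show "AE x in lebesgue. \<bar>(b x - cube_avg b ?Q) * ?f x\<bar> \<le> 1 * \<bar>enn2real (maximal_commutator b ?f x)\<bar>"
        using C0(1)[OF f]
      proof eventually_elim
        case (elim x)
        show ?case
        proof (cases "x \<in> ?Q")
          case True
          have "ennreal \<bar>b x - cube_avg b ?Q\<bar> * ennreal (l ^ CARD('n)) \<le> (\<integral>\<^sup>+y\<in>?Q. ennreal \<bar>b x - b y\<bar> \<partial>lebesgue)"
            using cube_avg_dist_le[OF b l, of "b x" a] l by (simp add: ennreal_mult)
          also have "\<dots> = (\<integral>\<^sup>+y\<in>?Q. ennreal (\<bar>b x - b y\<bar> * \<bar>?f y\<bar>) \<partial>lebesgue)"
            by (intro nn_integral_cong) (auto simp: indicator_def)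
          finally have "ennreal \<bar>b x - cube_avg b ?Q\<bar> * ennreal (l ^ CARD('n)) / ennreal (l ^ CARD('n)) \<le>
              (\<integral>\<^sup>+y\<in>?Q. ennreal (\<bar>b x - b y\<bar> * \<bar>?f y\<bar>) \<partial>lebesgue) / ennreal (l ^ CARD('n))"
            by (rule divide_right_mono_ennreal)
          then have "ennreal \<bar>b x - cube_avg b ?Q\<bar> \<le> (\<integral>\<^sup>+y\<in>?Q. ennreal (\<bar>b x - b y\<bar> * \<bar>?f y\<bar>) \<partial>lebesgue) / ennreal (l ^ CARD('n))"
            using l ennreal_mult_divide_eq[of "ennreal (l ^ CARD('n))" "ennreal \<bar>b x - cube_avg b ?Q\<bar>"] by simp
          also have "\<dots> \<le> maximal_commutator b ?f x"
            unfolding maximal_commutator_def Q(1)[symmetric]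
            using l True by (intro SUP_upper) (auto simp: cubes_iff)
          finally have "enn2real (ennreal \<bar>b x - cube_avg b ?Q\<bar>) \<le> enn2real (maximal_commutator b ?f x)"
            using elim by (intro enn2real_mono) auto
          then show ?thesis
            using True by simp
        qed simp
      qed
    qed auto
    also have "\<dots> \<le> ennreal C * var_Lp_norm p ?f"
      using order_trans[OF C0(2)[OF f] mult_right_mono[OF C(2)]] by simp
    also have "\<dots> \<le> ennreal C * (ennreal (2 * l powr \<beta>) * var_Lp_norm q ?f)"
      by (intro mult_left_mono var_Lp_norm_indicator_cube_pair_le[OF p q \<beta> rel l]) simp
    also have "\<dots> = ennreal C * ennreal (2 * l powr \<beta>) * var_Lp_norm q ?f"
      by (simp only: mult.assoc)
    also have "ennreal C * ennreal (2 * l powr \<beta>) = ennreal (C * (2 * l powr \<beta>))"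
      using C l by (intro ennreal_mult[symmetric]) auto
    also have "C * (2 * l powr \<beta>) = 2 * C * l powr \<beta>"
      by simp
    finally show "var_Lp_norm q (\<lambda>x. (b x - cube_avg b ?Q) * ?f x) \<le> ennreal (2 * C * l powr \<beta>) * var_Lp_norm q ?f" .
  qed (use C in simp)
  also have "\<dots> < \<infinity>" by simp
  finally show ?thesis .
qed

text \<open>Multiplying the admissible exponent \<open>q x * (n - \<beta>) / n\<close> by
  \<open>n / (n - \<beta>) > 1\<close> returns \<open>q\<close>, so \<open>exponents_B_scale\<close>
  applies.\<close>

lemma exponent_pairs_snd_exponents_B:
  fixes p q :: "real ^ 'n \<Rightarrow> real"
  assumes pq: "(p, q) \<in> exponent_pairs \<beta>" and \<beta>: "0 < \<beta>" "\<beta> < 1"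
  shows "q \<in> exponents_B"
proof -
  define n where "n = real CARD('n)"
  have "1 \<le> CARD('n)"
    by (simp add: Suc_le_eq)
  then have n: "1 \<le> n"
    by (simp add: n_def)
  have "(\<lambda>x. q x * (n - \<beta>) / n) \<in> exponents_B"
    using pq by (auto simp: exponent_pairs_def n_def)
  moreover have "1 < n / (n - \<beta>)"
    using n \<beta> by simp
  ultimately have "(\<lambda>x. n / (n - \<beta>) * (q x * (n - \<beta>) / n)) \<in> exponents_B"
    by (rule exponents_B_scale)
  also have "(\<lambda>x. n / (n - \<beta>) * (q x * (n - \<beta>) / n)) = q"
    using n \<beta> by simp
  finally show ?thesis .
qed

text \<open>Let \<open>r\<close> be the mean of \<open>\<bar>h\<bar>\<close> over the cube. Since
  \<open>r\<close> is at most the maximal function of \<open>h\<close> there, boundedness gives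
  \<open>r * N \<le> C * S * l powr \<beta> * N\<close>, where \<open>N\<close> is the norm of the
  indicator. It is positive and finite and cancels.\<close>

lemma mean_oscillation_le:
  fixes b q :: "real ^ 'n \<Rightarrow> real"
  assumes b: "locally_integrable b" and q: "q \<in> exponents_B" and fin: "osc_sup \<beta> q b < \<infinity>"
  obtains A where "0 \<le> A" "\<And>a l. 0 < l \<Longrightarrow>
    (\<integral>\<^sup>+y\<in>cube a l. ennreal \<bar>b y - cube_avg b (cube a l)\<bar> \<partial>lebesgue) \<le> ennreal (A * l powr \<beta> * l ^ CARD('n))"
proof -
  note [measurable] = locally_integrable_measurable[OF b]
  have qv: "q \<in> variable_exponents" and bd: "bounded_operator maximal_fun q q"
    using q by (auto simp: exponents_B_def exponents_P_def)
  obtain C0 where C0: "\<And>f. f \<in> var_Lp q \<Longrightarrow> (AE x in lebesgue. maximal_fun f x < \<infinity>)"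
      "\<And>f. f \<in> var_Lp q \<Longrightarrow> var_Lp_norm q (\<lambda>x. enn2real (maximal_fun f x)) \<le> ennreal C0 * var_Lp_norm q f"
    using bd unfolding bounded_operator_def by blast
  define C where "C = \<bar>C0\<bar>"
  have C: "0 \<le> C" "ennreal C0 \<le> ennreal C"
    by (auto simp: C_def intro: ennreal_leI)
  define S where "S = enn2real (osc_sup \<beta> q b)"
  have S: "0 \<le> S" "osc_sup \<beta> q b = ennreal S"
    using fin by (auto simp: S_def)
  have "(\<integral>\<^sup>+y\<in>cube a l. ennreal \<bar>b y - cube_avg b (cube a l)\<bar> \<partial>lebesgue) \<le> ennreal (C * S * l powr \<beta> * l ^ CARD('n))"
    if l: "0 < l" for a l
  proof -
    let ?Q = "cube a l"
    define h where "h = (\<lambda>x. (b x - cube_avg b ?Q) * indicator ?Q x)"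
    have [measurable]: "h \<in> borel_measurable lebesgue"
      unfolding h_def by measurable
    define v where "v = l ^ CARD('n)"
    have v: "0 < v" "emeasure lebesgue ?Q = ennreal v" "measure lebesgue ?Q = v"
      using l emeasure_cube[of l a] measure_cube[of l a] by (simp_all add: v_def del: emeasure_completion)
    define N where "N = var_Lp_norm q (indicator ?Q)"
    have N: "N \<noteq> 0" "N < top"
      using var_Lp_norm_indicator_cube_pos[OF qv l, of a] var_Lp_norm_finite[OF qv indicator_cube_var_Lp[OF qv l, of a]]
      by (auto simp: N_def)
    have vl: "v powr (\<beta> / real CARD('n)) = l powr \<beta>"
      using l by (simp add: v_def powr_powr flip: powr_realpow)
    have "ennreal (1 / l powr \<beta>) * (var_Lp_norm q h / N) \<le> ennreal S"
      unfolding S(2)[symmetric] osc_sup_def N_def h_def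
      using l by (intro SUP_upper2[of ?Q]) (auto simp: cubes_iff v vl)
    then have "ennreal (l powr \<beta>) * (ennreal (1 / l powr \<beta>) * (var_Lp_norm q h / N)) \<le> ennreal (l powr \<beta>) * ennreal S"
      by (intro mult_left_mono) auto
    also have "ennreal (l powr \<beta>) * (ennreal (1 / l powr \<beta>) * (var_Lp_norm q h / N)) = var_Lp_norm q h / N"
      using l by (simp add: ennreal_mult[symmetric] flip: mult.assoc)
    finally have hN: "var_Lp_norm q h \<le> ennreal (l powr \<beta>) * ennreal S * N"
      by (rule divide_le_ennreal_iff[OF N, THEN iffD1])
    also have "\<dots> < top"
      using N by (simp add: ennreal_mult_less_top)
    finally have h: "h \<in> var_Lp q"
      by (auto simp: var_Lp_norm_def split: if_splits)
    define I where "I = (\<integral>\<^sup>+y\<in>?Q. ennreal \<bar>h y\<bar> \<partial>lebesgue)"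
    have M: "I \<le> maximal_fun h x * ennreal v" if "x \<in> ?Q" for x
      unfolding I_def v(2)[symmetric] by (rule avg_le_maximal_fun[OF l that])
    have I: "(\<integral>\<^sup>+y\<in>?Q. ennreal \<bar>b y - cube_avg b ?Q\<bar> \<partial>lebesgue) = I"
      unfolding I_def h_def by (intro nn_integral_cong) (auto simp: indicator_def)
    \<comment> \<open>A cube has positive measure and the maximal function of \<open>h\<close> is
      finite almost everywhere, so some point of the cube bounds \<open>I\<close>.\<close>
    have "I < top"
    proof -
      have "?Q \<notin> null_sets lebesgue"
        using v by (auto simp: null_sets_def simp del: emeasure_completion)
      then have "\<not> (AE x in lebesgue. x \<notin> ?Q)"
        using AE_iff_null_sets[OF sets_cube, of a l] by blast
      moreover have "AE x in lebesgue. x \<notin> ?Q" if "\<And>x. x \<in> ?Q \<Longrightarrow> \<not> maximal_fun h x < \<infinity>"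
        using C0(1)[OF h] by eventually_elim (use that in blast)
      ultimately obtain x where x: "x \<in> ?Q" "maximal_fun h x < \<infinity>"
        by blast
      have "I \<le> maximal_fun h x * ennreal v"
        by (rule M[OF x(1)])
      also have "\<dots> < top"
        using x(2) by (simp add: ennreal_mult_less_top)
      finally show ?thesis .
    qed
    define r where "r = enn2real I / v"
    have r: "0 \<le> r" "I = ennreal (r * v)"
      using v \<open>I < top\<close> by (simp_all add: r_def)
    have "r \<le> C * (S * l powr \<beta>)"
    proof (cases "r = 0")
      case False
      with r have r0: "0 < r" by simp
      have "N \<le> ennreal (1 / r) * var_Lp_norm q (\<lambda>x. enn2real (maximal_fun h x))"
        unfolding N_def
      proof (rule var_Lp_norm_mono_AE[OF qv])
        show "AE x in lebesgue. \<bar>indicator ?Q x\<bar> \<le> 1 / r * \<bar>enn2real (maximal_fun h x)\<bar>"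
          using C0(1)[OF h]
        proof eventually_elim
          case (elim x)
          then obtain m where m: "0 \<le> m" "maximal_fun h x = ennreal m"
            by (cases "maximal_fun h x") auto
          show ?case
          proof (cases "x \<in> ?Q")
            case True
            then have "ennreal (r * v) \<le> ennreal (m * v)"
              using M[of x] r m v by (simp add: ennreal_mult)
            then have "r \<le> m"
              using v m by (simp add: ennreal_le_iff)
            then show ?thesis
              using True m r0 by simp
          qed (use r0 in simp)
        qed
      qed (use r0 in auto)
      also have "\<dots> \<le> ennreal (1 / r) * (ennreal C * (ennreal (l powr \<beta>) * ennreal S * N))"
        by (intro mult_left_mono order_trans[OF C0(2)[OF h]] mult_mono C(2) hN zero_le)
      also have "\<dots> = ennreal (1 / r) * ennreal C * ennreal (l powr \<beta>) * ennreal S * N"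
        by (simp only: mult.assoc)
      also have "ennreal (1 / r) * ennreal C * ennreal (l powr \<beta>) * ennreal S = ennreal (1 / r * C * l powr \<beta> * S)"
        using r0 C S l by (simp add: ennreal_mult[symmetric])
      also have "1 / r * C * l powr \<beta> * S = C * (S * l powr \<beta>) / r"
        by simp
      finally have "N / N \<le> ennreal (C * (S * l powr \<beta>) / r) * N / N"
        by (rule divide_right_mono_ennreal)
      then have "1 \<le> ennreal (C * (S * l powr \<beta>) / r)"
        using N by (simp add: ennreal_mult_divide_eq)
      then show ?thesis
        using r0 by (simp add: field_simps)
    qed (use C S in auto)
    then show ?thesis
      unfolding I r(2) v_def[symmetric] using v by (intro ennreal_leI) simp
  qed
  moreover have "0 \<le> C * S"
    using C S by simp
  ultimately show ?thesis
    by (rule that[rotated])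
qed

section \<open>Mean oscillation and Lipschitz continuity\<close>

text \<open>The cube is cut into congruent cubes of half the side and the hypothesis is used on ever
  smaller pieces. Their volumes add up to that of the cube, while the factor
  \<open>l powr \<beta>\<close> shrinks at every level.\<close>

lemma nn_integral_cube_halving:
  fixes h :: "real ^ 'n \<Rightarrow> ennreal"
  assumes [measurable]: "h \<in> borel_measurable lebesgue" and E: "0 \<le> E"
    and le: "\<And>a l. 0 < l \<Longrightarrow> (\<integral>\<^sup>+y\<in>cube a l. h y \<partial>lebesgue) \<le> ennreal (E * l powr \<beta> * l ^ CARD('n))"
    and l: "0 < l"
  shows "(\<integral>\<^sup>+y\<in>cube a l. h y \<partial>lebesgue) \<le> ennreal (E * (l / 2 ^ j) powr \<beta> * l ^ CARD('n))"
  using l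
proof (induction j arbitrary: a l)
  case 0
  then show ?case using le[of l a] by simp
next
  case (Suc j)
  \<comment> \<open>A set \<open>S\<close> of coordinates names the half-size cube shifted by
    \<open>l / 2\<close> in exactly the directions in \<open>S\<close>.\<close>
  define v where "v = (\<lambda>S. (\<chi> i. a $ i + (if i \<in> S then l / 2 else 0)) :: real ^ 'n)"
  have cov: "cube a l \<subseteq> (\<Union>S\<in>UNIV. cube (v S) (l / 2))"
  proof
    fix x assume x: "x \<in> cube a l"
    have "x \<in> cube (v {i. a $ i + l / 2 \<le> x $ i}) (l / 2)"
      unfolding mem_cube
    proof
      fix i
      have "a $ i \<le> x $ i \<and> x $ i \<le> a $ i + l"
        using x by (simp add: mem_cube)
      then show "v {i. a $ i + l / 2 \<le> x $ i} $ i \<le> x $ i \<and> x $ i \<le> v {i. a $ i + l / 2 \<le> x $ i} $ i + l / 2"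
        by (auto simp: v_def field_simps)
    qed
    then show "x \<in> (\<Union>S\<in>UNIV. cube (v S) (l / 2))" by blast
  qed
  have "(\<integral>\<^sup>+y\<in>cube a l. h y \<partial>lebesgue) \<le> (\<integral>\<^sup>+y. (\<Sum>S\<in>UNIV. h y * indicator (cube (v S) (l / 2)) y) \<partial>lebesgue)"
  proof (intro nn_integral_mono)
    fix y
    show "h y * indicator (cube a l) y \<le> (\<Sum>S\<in>UNIV. h y * indicator (cube (v S) (l / 2)) y)"
    proof (cases "y \<in> cube a l")
      case True
      then obtain S where "y \<in> cube (v S) (l / 2)"
        using cov by blast
      then have "h y * indicator (cube a l) y \<le> h y * indicator (cube (v S) (l / 2)) y"
        using True by simp
      also have "\<dots> \<le> (\<Sum>S\<in>UNIV. h y * indicator (cube (v S) (l / 2)) y)"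
        by (rule member_le_sum) auto
      finally show ?thesis .
    qed simp
  qed
  also have "\<dots> = (\<Sum>S\<in>UNIV. (\<integral>\<^sup>+y\<in>cube (v S) (l / 2). h y \<partial>lebesgue))"
    by (rule nn_integral_sum) measurable
  also have "\<dots> \<le> (\<Sum>S\<in>(UNIV::'n set set). ennreal (E * ((l / 2) / 2 ^ j) powr \<beta> * (l / 2) ^ CARD('n)))"
    using Suc.prems by (intro sum_mono Suc.IH) simp
  also have "\<dots> = ennreal (real (CARD('n set)) * (E * ((l / 2) / 2 ^ j) powr \<beta> * (l / 2) ^ CARD('n)))"
    using E Suc.prems by (simp add: ennreal_mult ennreal_of_nat_eq_real_of_nat)
  \<comment> \<open>There are 2 to the power n half-size cubes, which cancels the same power in
    \<open>(l / 2) ^ CARD('n)\<close>.\<close>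
  also have "real (CARD('n set)) * (E * ((l / 2) / 2 ^ j) powr \<beta> * (l / 2) ^ CARD('n)) = E * (l / 2 ^ Suc j) powr \<beta> * l ^ CARD('n)"
    by (simp add: card_set power_divide)
  finally show ?case .
qed

text \<open>Repeated halving drives the bound on each cube to 0, so \<open>h\<close> vanishes almost
  everywhere on every cube, and countably many cubes exhaust the space.\<close>

lemma AE_zero_if_cube_integrals_small:
  fixes h :: "real ^ 'n \<Rightarrow> ennreal"
  assumes h [measurable]: "h \<in> borel_measurable lebesgue" and E: "0 \<le> E" and \<beta>: "0 < \<beta>"
    and le: "\<And>a l. 0 < l \<Longrightarrow> (\<integral>\<^sup>+y\<in>cube a l. h y \<partial>lebesgue) \<le> ennreal (E * l powr \<beta> * l ^ CARD('n))"
  shows "AE x in lebesgue. h x = 0"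
proof -
  have zero: "AE x in lebesgue. h x * indicator (cube a l) x = 0" if l: "0 < l" for a l
  proof -
    have "(\<lambda>j. l / 2 ^ j) \<longlonglongrightarrow> 0"
      by (rule LIMSEQ_divide_realpow_zero) simp
    then have "(\<lambda>j. ennreal (E * (l / 2 ^ j) powr \<beta> * l ^ CARD('n))) \<longlonglongrightarrow> ennreal (E * 0 powr \<beta> * l ^ CARD('n))"
      using \<beta> l by (intro tendsto_ennrealI tendsto_intros tendsto_powr') auto
    then have "(\<lambda>j. ennreal (E * (l / 2 ^ j) powr \<beta> * l ^ CARD('n))) \<longlonglongrightarrow> 0"
      using \<beta> by simp
    then have "(\<integral>\<^sup>+y\<in>cube a l. h y \<partial>lebesgue) \<le> 0"
      by (rule LIMSEQ_le_const) (intro exI allI impI nn_integral_cube_halving[OF h E le l])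
    then have "(\<integral>\<^sup>+y\<in>cube a l. h y \<partial>lebesgue) = 0"
      by simp
    moreover have "(\<lambda>y. h y * indicator (cube a l) y) \<in> borel_measurable lebesgue"
      by measurable
    ultimately show ?thesis
      by (simp only: nn_integral_0_iff_AE)
  qed
  \<comment> \<open>These cubes are centred at the origin; the successor keeps the side positive for
    \<open>k = 0\<close>.\<close>
  have "AE x in lebesgue. \<forall>k::nat. h x * indicator (cube (\<chi> i. - real (Suc k)) (2 * real (Suc k))) x = 0"
    by (subst AE_all_countable) (intro allI zero, simp)
  then show ?thesis
  proof eventually_elim
    case (elim x)
    obtain k where k: "norm x \<le> real k"
      using real_arch_simple by blast
    have "- real (Suc k) \<le> x $ i \<and> x $ i \<le> - real (Suc k) + 2 * real (Suc k)" for i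
      using order_trans[OF component_le_norm_cart[of x i] k] by (auto simp: abs_le_iff)
    then have "x \<in> cube (\<chi> i. - real (Suc k)) (2 * real (Suc k))"
      unfolding mem_cube by simp
    with elim[rule_format, of k] show ?case
      by simp
  qed
qed

text \<open>Averages over shrinking cubes converge at a geometric rate. Their limit \<open>g\<close>
  is defined everywhere and is Lipschitz, because nearby points share a cube of comparable size;
  finally \<open>g\<close> is identified with \<open>b\<close> almost everywhere.\<close>

lemma lipschitz_if_mean_oscillation_le:
  fixes b :: "real ^ 'n \<Rightarrow> real"
  assumes b: "locally_integrable b" and \<beta>: "0 < \<beta>" and A: "0 \<le> A"
    and osc: "\<And>a l. 0 < l \<Longrightarrow>
      (\<integral>\<^sup>+y\<in>cube a l. ennreal \<bar>b y - cube_avg b (cube a l)\<bar> \<partial>lebesgue) \<le> ennreal (A * l powr \<beta> * l ^ CARD('n))"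
  shows "b \<in> hom_lipschitz \<beta>"
proof -
  \<comment> \<open>The cubes have their lower corner, not their centre, at \<open>x\<close>; those
    with the same corner are nested.\<close>
  define c where "c = (\<lambda>x l. cube_avg b (cube x l))"
  define K where "K = A * 2 ^ CARD('n)"
  have K: "0 \<le> K" using A by (simp add: K_def)
  \<comment> \<open>Integrating over the smaller cube instead of the larger costs at most the ratio
    of volumes, 2 to the power n, which is the extra factor in \<open>K\<close>.\<close>
  have nested: "\<bar>c a l - c x m\<bar> \<le> K * l powr \<beta>"
    if "0 < m" "0 < l" "l \<le> 2 * m" "cube x m \<subseteq> cube a l" for x a m l
  proof -
    have "ennreal (\<bar>c a l - c x m\<bar> * m ^ CARD('n)) \<le> (\<integral>\<^sup>+y\<in>cube x m. ennreal \<bar>c a l - b y\<bar> \<partial>lebesgue)"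
      unfolding c_def by (rule cube_avg_dist_le[OF b that(1)])
    also have "\<dots> \<le> (\<integral>\<^sup>+y\<in>cube a l. ennreal \<bar>b y - c a l\<bar> \<partial>lebesgue)"
      using that(4) by (intro nn_integral_mono) (auto simp: indicator_def abs_minus_commute)
    also have "\<dots> \<le> ennreal (A * l powr \<beta> * l ^ CARD('n))"
      unfolding c_def by (rule osc[OF that(2)])
    also have "\<dots> \<le> ennreal (A * l powr \<beta> * (2 * m) ^ CARD('n))"
      using that A by (intro ennreal_leI mult_left_mono power_mono) auto
    also have "A * l powr \<beta> * (2 * m) ^ CARD('n) = K * l powr \<beta> * m ^ CARD('n)"
      by (simp add: K_def power_mult_distrib)
    finally have "\<bar>c a l - c x m\<bar> * m ^ CARD('n) \<le> K * l powr \<beta> * m ^ CARD('n)"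
      using that K by (simp add: ennreal_le_iff)
    then show ?thesis
      using that(1) by simp
  qed
  \<comment> \<open>The sum of the geometric series of errors
    \<open>K * (1 / 2) powr (j * \<beta>)\<close>, used through the equation
    \<open>K + B * (1 / 2) powr \<beta> = B\<close>.\<close>
  define B where "B = K / (1 - (1 / 2) powr \<beta>)"
  have half: "(1 / 2 :: real) powr \<beta> < 1"
    using \<beta> powr_less_mono'[of "1 / 2 :: real" 0 \<beta>] by simp
  then have "1 - (1 / 2 :: real) powr \<beta> \<noteq> 0" by linarith
  with half have B0: "0 \<le> B" and "B * (1 - (1 / 2) powr \<beta>) = K"
    using K by (auto simp: B_def)
  then have B1: "K + B * (1 / 2) powr \<beta> = B"
    by (simp add: algebra_simps)
  moreover have "0 \<le> B * (1 / 2) powr \<beta>"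
    using B0 by simp
  ultimately have "K \<le> B"
    by linarith
  note B = B0 B1 this
  \<comment> \<open>Induction on the number of halvings between \<open>l\<close> and
    \<open>m\<close>: the first costs \<open>K * l powr \<beta>\<close>, the others together
    \<open>B * (l / 2) powr \<beta>\<close>, and the equation for \<open>B\<close> adds these
    up.\<close>
  have shrink: "\<bar>c x l - c x m\<bar> \<le> B * l powr \<beta>" if "0 < m" "m \<le> l" "l \<le> 2 ^ j * m" for x l m j
    using that
  proof (induction j arbitrary: l)
    case 0
    then show ?case using B by simp
  next
    case (Suc j)
    show ?case
    proof (cases "l \<le> 2 * m")
      case True
      then have "\<bar>c x l - c x m\<bar> \<le> K * l powr \<beta>"
        using Suc.prems by (intro nested cube_subset) auto
      also have "\<dots> \<le> B * l powr \<beta>"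
        using B by (intro mult_right_mono) auto
      finally show ?thesis .
    next
      case False
      have "\<bar>c x l - c x (l / 2)\<bar> \<le> K * l powr \<beta>"
        using Suc.prems by (intro nested cube_subset) auto
      moreover have "\<bar>c x (l / 2) - c x m\<bar> \<le> B * (l / 2) powr \<beta>"
        using Suc.prems False by (intro Suc.IH) auto
      moreover have "B * (l / 2) powr \<beta> = B * (1 / 2) powr \<beta> * l powr \<beta>"
        using Suc.prems by (simp add: powr_divide)
      moreover have "B * l powr \<beta> = K * l powr \<beta> + B * (1 / 2) powr \<beta> * l powr \<beta>"
        by (subst B(2)[symmetric]) (simp add: algebra_simps)
      ultimately show ?thesis by linarith
    qed
  qed
  have shrink': "\<bar>c x l - c x m\<bar> \<le> B * l powr \<beta>" if "0 < m" "m \<le> l" for x l m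
  proof -
    obtain j where "l / m < 2 ^ j"
      using real_arch_pow[of 2 "l / m"] by auto
    then show ?thesis
      using that by (intro shrink[of m l j]) (auto simp: field_simps)
  qed
  define u where "u = (\<lambda>x k. c x ((1 / 2) ^ k))"
  have half0: "(\<lambda>k. (1 / 2 :: real) ^ k) \<longlonglongrightarrow> 0"
    by (rule LIMSEQ_power_zero) simp
  have conv: "convergent (u x)" for x
  proof -
    have "(\<lambda>k. B * ((1 / 2) ^ k) powr \<beta>) \<longlonglongrightarrow> B * 0 powr \<beta>"
      using \<beta> by (intro tendsto_intros tendsto_powr' half0) auto
    then have lim: "(\<lambda>k. B * ((1 / 2) ^ k) powr \<beta>) \<longlonglongrightarrow> 0"
      using \<beta> by simp
    have "Cauchy (u x)"
    proof (rule CauchyI')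
      fix e :: real assume "0 < e"
      then have "eventually (\<lambda>k. B * ((1 / 2) ^ k) powr \<beta> < e) sequentially"
        using lim by (intro order_tendstoD(2)) auto
      then obtain k where k: "\<And>i. k \<le> i \<Longrightarrow> B * ((1 / 2) ^ i) powr \<beta> < e"
        by (auto simp: eventually_sequentially)
      have "dist (u x i) (u x j) < e" if "k \<le> i" "i < j" for i j
      proof -
        have "\<bar>u x i - u x j\<bar> \<le> B * ((1 / 2) ^ i) powr \<beta>"
          unfolding u_def using that by (intro shrink') (auto intro!: power_decreasing)
        with k[OF that(1)] show ?thesis by (simp add: dist_real_def)
      qed
      then show "\<exists>M. \<forall>m\<ge>M. \<forall>n>m. dist (u x m) (u x n) < e" by blast
    qed
    then show ?thesis by (simp add: Cauchy_convergent_iff)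
  qed
  define g where "g = (\<lambda>x. lim (u x))"
  have cg: "\<bar>c x l - g x\<bar> \<le> B * l powr \<beta>" if "0 < l" for x l
  proof -
    have "u x \<longlonglongrightarrow> g x"
      using conv[of x] by (simp add: g_def convergent_LIMSEQ_iff)
    then have "(\<lambda>k. \<bar>c x l - u x k\<bar>) \<longlonglongrightarrow> \<bar>c x l - g x\<bar>"
      by (intro tendsto_intros)
    moreover have "eventually (\<lambda>k. (1 / 2 :: real) ^ k < l) sequentially"
      using half0 that by (rule order_tendstoD(2))
    then have "eventually (\<lambda>k. \<bar>c x l - u x k\<bar> \<le> B * l powr \<beta>) sequentially"
      by eventually_elim (auto simp: u_def intro!: shrink')
    ultimately show ?thesis
      by (rule tendsto_upperbound) simp
  qed
  \<comment> \<open>Two comparisons with a common cube of side \<open>2 * l\<close> contribute the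
    terms with \<open>K\<close>, two passages from an average to its limit those with
    \<open>B\<close>.\<close>
  define D where "D = 2 * K * 2 powr \<beta> + 2 * B"
  have D: "0 \<le> D" using K B by (simp add: D_def)
  have K2: "K * (2 * l) powr \<beta> = K * 2 powr \<beta> * l powr \<beta>" if "0 < l" for l
    using that by (simp add: powr_mult)
  have gl: "\<bar>g x - g y\<bar> \<le> D * norm (x - y) powr \<beta>" for x y
  proof (cases "x = y")
    case False
    define l where "l = norm (x - y)"
    have l: "0 < l" using False by (simp add: l_def)
    \<comment> \<open>From the componentwise minimum a cube of side \<open>2 * l\<close> reaches far
      enough to contain both \<open>cube x l\<close> and \<open>cube y l\<close>.\<close>
    define a where "a = (\<chi> i. min (x $ i) (y $ i))"
    have comp: "\<bar>x $ i - y $ i\<bar> \<le> l" for i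
      using component_le_norm_cart[of "x - y" i] by (simp add: l_def)
    have "cube x l \<subseteq> cube a (2 * l)"
    proof (rule cube_subset)
      fix i show "a $ i \<le> x $ i \<and> x $ i + l \<le> a $ i + 2 * l"
        using comp[of i] by (auto simp: a_def min_def abs_le_iff)
    qed
    then have "\<bar>c a (2 * l) - c x l\<bar> \<le> K * (2 * l) powr \<beta>"
      using l by (intro nested) auto
    moreover have "cube y l \<subseteq> cube a (2 * l)"
    proof (rule cube_subset)
      fix i show "a $ i \<le> y $ i \<and> y $ i + l \<le> a $ i + 2 * l"
        using comp[of i] l by (auto simp: a_def min_def abs_le_iff)
    qed
    then have "\<bar>c a (2 * l) - c y l\<bar> \<le> K * (2 * l) powr \<beta>"
      using l by (intro nested) auto
    ultimately have "\<bar>g x - g y\<bar> \<le> 2 * (K * 2 powr \<beta> * l powr \<beta>) + 2 * (B * l powr \<beta>)"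
      using cg[OF l, of x] cg[OF l, of y] unfolding K2[OF l] by linarith
    then show ?thesis
      by (simp add: D_def l_def algebra_simps)
  qed simp
  have [measurable]: "b \<in> borel_measurable lebesgue"
    by (rule locally_integrable_measurable[OF b])
  have [measurable]: "g \<in> borel_measurable lebesgue"
    using borel_measurable_continuous_onI[OF lipschitz_continuous[OF gl \<beta>]] by (simp add: measurable_completion)
  \<comment> \<open>On a cube of side \<open>l\<close>, both \<open>b\<close> in the mean and
    \<open>g\<close> pointwise are within a multiple of \<open>l powr \<beta>\<close> of the same
    average. The integral of their distance is thus small enough for the halving argument.\<close>
  have "AE x in lebesgue. ennreal \<bar>b x - g x\<bar> = 0"
  proof (rule AE_zero_if_cube_integrals_small[OF _ _ \<beta>])
    show "0 \<le> A + D" using A D by simp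
    fix a :: "real ^ 'n" and l :: real assume l: "0 < l"
    have gc: "\<bar>g y - c a l\<bar> \<le> D * l powr \<beta>" if y: "y \<in> cube a l" for y
    proof -
      have "a $ i \<le> y $ i \<and> y $ i + l \<le> a $ i + 2 * l" for i
        using y[unfolded mem_cube, rule_format, of i] by simp
      then have "cube y l \<subseteq> cube a (2 * l)"
        by (rule cube_subset)
      moreover have "cube a l \<subseteq> cube a (2 * l)"
        using l by (intro cube_subset) simp
      ultimately have "\<bar>c a (2 * l) - c a l\<bar> \<le> K * (2 * l) powr \<beta>" "\<bar>c a (2 * l) - c y l\<bar> \<le> K * (2 * l) powr \<beta>"
        using l by (auto intro!: nested)
      moreover have "0 \<le> B * l powr \<beta>" using B by simp
      ultimately have "\<bar>g y - c a l\<bar> \<le> 2 * (K * 2 powr \<beta> * l powr \<beta>) + 2 * (B * l powr \<beta>)"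
        using cg[OF l, of y] unfolding K2[OF l] by linarith
      then show ?thesis
        by (simp add: D_def algebra_simps)
    qed
    have "(\<integral>\<^sup>+y\<in>cube a l. ennreal \<bar>b y - g y\<bar> \<partial>lebesgue) \<le>
        (\<integral>\<^sup>+y. ennreal \<bar>b y - c a l\<bar> * indicator (cube a l) y + ennreal (D * l powr \<beta>) * indicator (cube a l) y \<partial>lebesgue)"
    proof (intro nn_integral_mono)
      fix y
      have "\<bar>b y - g y\<bar> \<le> \<bar>b y - c a l\<bar> + D * l powr \<beta>" if "y \<in> cube a l"
        using gc[OF that] by linarith
      then show "ennreal \<bar>b y - g y\<bar> * indicator (cube a l) y \<le>
        ennreal \<bar>b y - c a l\<bar> * indicator (cube a l) y + ennreal (D * l powr \<beta>) * indicator (cube a l) y"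
        using D by (auto simp: indicator_def ennreal_plus[symmetric] simp del: ennreal_plus intro!: ennreal_leI)
    qed
    also have "\<dots> = (\<integral>\<^sup>+y\<in>cube a l. ennreal \<bar>b y - c a l\<bar> \<partial>lebesgue) + ennreal (D * l powr \<beta>) * ennreal (l ^ CARD('n))"
      using l emeasure_cube[of l a]
      by (subst nn_integral_add) (auto simp: nn_integral_cmult_indicator simp del: emeasure_completion)
    also have "\<dots> \<le> ennreal (A * l powr \<beta> * l ^ CARD('n)) + ennreal (D * l powr \<beta>) * ennreal (l ^ CARD('n))"
      unfolding c_def by (intro add_right_mono osc l)
    also have "\<dots> = ennreal ((A + D) * l powr \<beta> * l ^ CARD('n))"
      using A D l by (simp add: ennreal_mult[symmetric] ennreal_plus[symmetric] distrib_right del: ennreal_plus)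
    finally show "(\<integral>\<^sup>+y\<in>cube a l. ennreal \<bar>b y - g y\<bar> \<partial>lebesgue) \<le> ennreal ((A + D) * l powr \<beta> * l ^ CARD('n))" .
  qed measurable
  then have "AE x in lebesgue. b x = g x"
    by eventually_elim simp
  then show ?thesis
    unfolding hom_lipschitz_def using gl by blast
qed

theorem corollary1p1:
  fixes b :: "real ^ 'n \<Rightarrow> real" and \<beta> :: real
  assumes "locally_integrable b" and "0 < \<beta>" and "\<beta> < 1"
  shows "(b \<in> hom_lipschitz \<beta> \<longleftrightarrow>
            (\<forall>(p, q)\<in>exponent_pairs \<beta>. bounded_operator (maximal_commutator b) p q)) \<and>
         (b \<in> hom_lipschitz \<beta> \<longleftrightarrow>
            (\<exists>(p, q)\<in>exponent_pairs \<beta>. bounded_operator (maximal_commutator b) p q)) \<and>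
         (b \<in> hom_lipschitz \<beta> \<longleftrightarrow> (\<exists>q\<in>exponents_B. osc_sup \<beta> q b < \<infinity>)) \<and>
         (b \<in> hom_lipschitz \<beta> \<longleftrightarrow> (\<forall>q\<in>exponents_B. osc_sup \<beta> q b < \<infinity>))"
proof -
  have osc_imp_lip: "b \<in> hom_lipschitz \<beta>" if "q \<in> exponents_B" "osc_sup \<beta> q b < \<infinity>" for q
    by (rule mean_oscillation_le[OF assms(1) that]) (rule lipschitz_if_mean_oscillation_le[OF assms(1,2)])
  have lip_imp_osc: "osc_sup \<beta> q b < \<infinity>" if "b \<in> hom_lipschitz \<beta>" "q \<in> exponents_B" for q
    using that by (intro osc_sup_finite_if_lipschitz assms) (auto simp: exponents_B_def exponents_P_def)
  have lip_imp_bd: "bounded_operator (maximal_commutator b) p q"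
    if "b \<in> hom_lipschitz \<beta>" "(p, q) \<in> exponent_pairs \<beta>" for p q
    using that assms by (intro maximal_commutator_bounded)
  have bd_imp_lip: "b \<in> hom_lipschitz \<beta>"
    if "(p, q) \<in> exponent_pairs \<beta>" "bounded_operator (maximal_commutator b) p q" for p q
    using that assms by (intro osc_imp_lip[of q] exponent_pairs_snd_exponents_B osc_sup_finite_if_bounded)
  \<comment> \<open>A concrete pair makes the universal assertion about the commutator imply the
    existential one.\<close>
  obtain p0 q0 :: "real ^ 'n \<Rightarrow> real" where pq0: "(p0, q0) \<in> exponent_pairs \<beta>"
    using exponent_pairs_nonempty[OF assms(2,3)] by (metis equals0I surj_pair)
  have "b \<in> hom_lipschitz \<beta> \<longleftrightarrow>
      (\<forall>(p, q)\<in>exponent_pairs \<beta>. bounded_operator (maximal_commutator b) p q)"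
    using lip_imp_bd bd_imp_lip pq0 by fast
  moreover have "b \<in> hom_lipschitz \<beta> \<longleftrightarrow>
      (\<exists>(p, q)\<in>exponent_pairs \<beta>. bounded_operator (maximal_commutator b) p q)"
    using lip_imp_bd bd_imp_lip pq0 by fast
  moreover have "b \<in> hom_lipschitz \<beta> \<longleftrightarrow> (\<exists>q\<in>exponents_B. osc_sup \<beta> q b < \<infinity>)"
    using osc_imp_lip lip_imp_osc const_2_exponents_B by blast
  moreover have "b \<in> hom_lipschitz \<beta> \<longleftrightarrow> (\<forall>q\<in>exponents_B. osc_sup \<beta> q b < \<infinity>)"
    using osc_imp_lip lip_imp_osc const_2_exponents_B by blast
  ultimately show ?thesis by blast
qed

end
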